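(* In the variable-assignment setting, suppose that $\Pr_\Omega(B)\le p$ and $|N(B)|\le d$ for all $B\in\mathcal B$, where $e\,p\,d\le 1$. Let $\mathcal A=\{A_1,\dots,A_m\}$ be a finite set of events in $\Omega$ with $|N(A)|\le r$ for each $A\in\mathcal A$, and let $\vee\mathcal A=A_1\cup\dots\cup A_m$. Then $$\Pr_{\mathrm{MT}}(\vee\mathcal A)\ \le\ \Pr_\Omega(\vee\mathcal A)\,(1+e p)^r .$$
   Context: Variable-assignment setting: $\Omega$ is a product probability space with independent random variables $X(1),\dots,X(n)$. Every event $E$ considered is a boolean function of the variables in a specified subset $\mathrm{var}(E)\subseteq\{1,\dots,n\}$, and $E\sim E'$ means $\mathrm{var}(E)\cap\mathrm{var}(E')\ne\emptyset$. $\mathcal B$ is a finite collection of events (the bad-events). For an event $E$, $N(E)=\{B\in\mathcal B: B\sim E\}$ (for $B\in\mathcal B$ this is the inclusive neighborhood, so $B\in N(B)$). MT (Moser–Tardos) algorithm: draw $X\sim\Omega$; while some $B\in\mathcal B$ is true on $X$, choose some true $B\in\mathcal B$ (by an arbitrary fixed, possibly randomized, rule) and resample all variables in $\mathrm{var}(B)$ independently from their distributions in $\Omega$. Under the stated hypotheses (the symmetric Lovász Local Lemma criterion) it terminates with probability one. $\Pr_{\mathrm{MT}}$ denotes probability with respect to the distribution of $X$ at termination; the result holds for every choice of selection rule. Here $e$ is the base of the natural logarithm. *)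

theory Defs
  imports "HOL-Probability.Probability"
begin

text \<open>
  The probability space \<open>\<Omega>\<close> carrying the independent variables \<open>X(1), \<dots>, X(n)\<close>; the variable
  \<open>X(i)\<close> is the \<open>i\<close>-th coordinate and has the arbitrary distribution \<open>M i\<close>.
\<close>

definition Omega :: "nat \<Rightarrow> (nat \<Rightarrow> 'a measure) \<Rightarrow> (nat \<Rightarrow> 'a) measure" where
  "Omega n M = PiM {1..n} M"

text \<open>
  An event comes with its specified set of variables, so \<open>vars E\<close> need not be the least set of
  variables that determines \<open>outcomes E\<close>.
\<close>

datatype 'a event = Event (vars: "nat set") (outcomes: "(nat \<Rightarrow> 'a) set")

definition is_event :: "nat \<Rightarrow> (nat \<Rightarrow> 'a measure) \<Rightarrow> 'a event \<Rightarrow> bool" where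
  "is_event n M E \<longleftrightarrow>
     vars E \<subseteq> {1..n} \<and>
     outcomes E \<in> sets (Omega n M) \<and>
     (\<forall>x\<in>space (Omega n M). \<forall>y\<in>space (Omega n M).
        (\<forall>i\<in>vars E. x i = y i) \<longrightarrow> (x \<in> outcomes E \<longleftrightarrow> y \<in> outcomes E))"

definition dependent :: "'a event \<Rightarrow> 'a event \<Rightarrow> bool" where
  "dependent E E' \<longleftrightarrow> vars E \<inter> vars E' \<noteq> {}"

definition neighbourhood :: "'a event set \<Rightarrow> 'a event \<Rightarrow> 'a event set" where
  "neighbourhood \<B> E = {B \<in> \<B>. dependent B E}"

text \<open>
  The law of the configuration after the variables of \<open>B\<close> have been resampled in the
  configuration \<open>x\<close>: a fresh sample \<open>y\<close> of \<open>\<Omega>\<close> overwrites \<open>x\<close> on \<open>vars B\<close>.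
\<close>

definition resample :: "nat \<Rightarrow> (nat \<Rightarrow> 'a measure) \<Rightarrow> 'a event \<Rightarrow> (nat \<Rightarrow> 'a) \<Rightarrow> (nat \<Rightarrow> 'a) measure" where
  "resample n M B x =
     distr (Omega n M) (Omega n M) (\<lambda>y. \<lambda>i\<in>{1..n}. if i \<in> vars B then y i else x i)"

text \<open>
  A run of the Moser--Tardos algorithm is a sequence of snapshots: snapshot \<open>t\<close> holds the
  configuration after \<open>t\<close> steps and the bad-event resampled in the \<open>t\<close>-th step, with \<open>None\<close> for
  the initial draw and for the idle steps that follow termination.
\<close>

type_synonym 'a snapshot = "(nat \<Rightarrow> 'a) \<times> 'a event option"

definition snapshot_space :: "nat \<Rightarrow> (nat \<Rightarrow> 'a measure) \<Rightarrow> 'a snapshot measure" where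
  "snapshot_space n M = Omega n M \<Otimes>\<^sub>M count_space UNIV"

text \<open>
  After \<open>t\<close> steps the history consists of the snapshots \<open>0, \<dots>, t\<close>. A selection rule maps \<open>t\<close> and
  this history to a distribution on the bad-events that are true on the current configuration;
  it may thus be randomized and may use everything that happened so far. Its value on histories
  that end in a configuration without true bad-events is irrelevant.
\<close>

type_synonym 'a rule = "nat \<Rightarrow> (nat \<Rightarrow> 'a snapshot) \<Rightarrow> 'a event pmf"

definition is_selection_rule ::
    "nat \<Rightarrow> (nat \<Rightarrow> 'a measure) \<Rightarrow> 'a event set \<Rightarrow> 'a rule \<Rightarrow> bool" where
  "is_selection_rule n M \<B> sel \<longleftrightarrow>
     (\<forall>t. \<forall>B\<in>\<B>. (\<lambda>h. pmf (sel t h) B) \<in>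
        borel_measurable (PiM {0..<Suc t} (\<lambda>_. snapshot_space n M))) \<and>
     (\<forall>t. \<forall>h\<in>space (PiM {0..<Suc t} (\<lambda>_. snapshot_space n M)).
        (\<exists>B\<in>\<B>. fst (h t) \<in> outcomes B) \<longrightarrow>
        set_pmf (sel t h) \<subseteq> {B\<in>\<B>. fst (h t) \<in> outcomes B})"

text \<open>The conditional law of snapshot \<open>t\<close> given the snapshots \<open>0, \<dots>, t - 1\<close>.\<close>

primrec MT_kernel ::
    "nat \<Rightarrow> (nat \<Rightarrow> 'a measure) \<Rightarrow> 'a event set \<Rightarrow> 'a rule \<Rightarrow>
     nat \<Rightarrow> (nat \<Rightarrow> 'a snapshot) \<Rightarrow> 'a snapshot measure" where
  "MT_kernel n M \<B> sel 0 h =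
     distr (Omega n M) (snapshot_space n M) (\<lambda>x. (x, None))"
| "MT_kernel n M \<B> sel (Suc t) h =
     (if \<exists>B\<in>\<B>. fst (h t) \<in> outcomes B
      then measure_pmf (sel t h) \<bind>
             (\<lambda>B. distr (resample n M B (fst (h t))) (snapshot_space n M) (\<lambda>x. (x, Some B)))
      else return (snapshot_space n M) (fst (h t), None))"

text \<open>
  The law of the infinite run (Ionescu-Tulcea). The locale predicate \<open>Ionescu_Tulcea\<close> holds for these
  arguments whenever \<open>\<B>\<close> is a finite set of events and \<open>sel\<close> is a selection rule.
\<close>

definition MT_runs ::
    "nat \<Rightarrow> (nat \<Rightarrow> 'a measure) \<Rightarrow> 'a event set \<Rightarrow> 'a rule \<Rightarrow> (nat \<Rightarrow> 'a snapshot) measure" where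
  "MT_runs n M \<B> sel =
     projective_family.lim UNIV
       (Ionescu_Tulcea.CI (MT_kernel n M \<B> sel) (\<lambda>_. snapshot_space n M))
       (\<lambda>_. snapshot_space n M)"

definition terminates_at :: "'a event set \<Rightarrow> (nat \<Rightarrow> 'a snapshot) \<Rightarrow> nat \<Rightarrow> bool" where
  "terminates_at \<B> \<omega> t \<longleftrightarrow>
     (\<forall>B\<in>\<B>. fst (\<omega> t) \<notin> outcomes B) \<and>
     (\<forall>s<t. \<exists>B\<in>\<B>. fst (\<omega> s) \<in> outcomes B)"

text \<open>The probability that the configuration at termination lies in \<open>S\<close>.\<close>

definition MT_prob ::
    "nat \<Rightarrow> (nat \<Rightarrow> 'a measure) \<Rightarrow> 'a event set \<Rightarrow> 'a rule \<Rightarrow> (nat \<Rightarrow> 'a) set \<Rightarrow> real" where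
  "MT_prob n M \<B> sel S =
     measure (MT_runs n M \<B> sel)
       {\<omega> \<in> space (MT_runs n M \<B> sel). \<exists>t. terminates_at \<B> \<omega> t \<and> fst (\<omega> t) \<in> S}"

end

theory Submission
  imports Defs
begin

text \<open>
  Assign to every variable \<open>i\<close> an infinite stack of independent samples, the cells \<open>(i, 0)\<close>,
  \<open>(i, 1)\<close>, \<dots>; the top cells form the configuration, and resampling \<open>B\<close> pops the stacks of
  \<open>vars B\<close>. The probability that some sequence of legal resamplings leads from a configuration \<open>x\<close>
  to an event \<open>E\<close> is a supermartingale along every run, since the step that the rule selects may
  be prepended to such a sequence. So it suffices to bound the probability, over random stacks,
  that some legal sequence of resamplings reaches \<open>E = \<Union>A\<in>\<A>. outcomes A\<close>.

  Group a sequence into layers of events with disjoint variables, push every event to the latest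
  possible layer, and drop it if it does not touch the event \<open>A \<in> \<A>\<close> that is first, in a fixed
  enumeration, among those that hold in the end. A minimal sequence allows no such step; then the last
  layer lies in \<open>N(A)\<close> and every other layer in the neighbourhood of its successor. A given layering
  is legal with probability at most \<open>p ^ (number of events)\<close>, independently of the
  configuration it leads to. Hence the sum over the layerings that belong to \<open>A\<close>, at most
  \<open>(1 + exp 1 * p) ^ r\<close> by induction on the number of layers, multiplies the probability that \<open>A\<close>
  is the first event to hold; these probabilities add up to that of \<open>E\<close>.
\<close>

section \<open>The table of samples\<close>

declare One_nat_def [simp del]

definition current :: "nat \<Rightarrow> (nat \<times> nat \<Rightarrow> 'a) \<Rightarrow> nat \<Rightarrow> 'a" where
  "current n Y = (\<lambda>i\<in>{1..n}. Y (i, 0))"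

text \<open>\<open>advance n V\<close> pops the stacks of the variables in \<open>V\<close>; \<open>glue n V y\<close> pushes \<open>y\<close> onto them.\<close>

definition advance :: "nat \<Rightarrow> nat set \<Rightarrow> (nat \<times> nat \<Rightarrow> 'a) \<Rightarrow> nat \<times> nat \<Rightarrow> 'a" where
  "advance n V Y = (\<lambda>j\<in>{1..n} \<times> UNIV. Y (fst j, if fst j \<in> V then Suc (snd j) else snd j))"

definition glue :: "nat \<Rightarrow> nat set \<Rightarrow> (nat \<Rightarrow> 'a) \<Rightarrow> (nat \<times> nat \<Rightarrow> 'a) \<Rightarrow> nat \<times> nat \<Rightarrow> 'a" where
  "glue n V y Y = (\<lambda>j\<in>{1..n} \<times> UNIV.
     if fst j \<in> V then (case snd j of 0 \<Rightarrow> y (fst j) | Suc k \<Rightarrow> Y (fst j, k)) else Y j)"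

locale independent_variables =
  fixes n :: nat and M :: "nat \<Rightarrow> 'a measure"
  assumes prob_space_variable: "i \<in> {1..n} \<Longrightarrow> prob_space (M i)"
begin

definition table :: "(nat \<times> nat \<Rightarrow> 'a) measure" where
  "table = PiM ({1..n} \<times> UNIV) (\<lambda>j. M (fst j))"

sublocale Omega: prob_space "Omega n M"
  unfolding Omega_def by (intro prob_space_PiM prob_space_variable)

sublocale table: prob_space table
  unfolding table_def by (intro prob_space_PiM prob_space_variable) auto

lemma prob_space_PiM_vars: "V \<subseteq> {1..n} \<Longrightarrow> prob_space (PiM V M)"
  by (intro prob_space_PiM prob_space_variable) auto

lemma measurable_cell:
  "i \<in> {1..n} \<Longrightarrow> (\<lambda>Y. Y (i, k)) \<in> table \<rightarrow>\<^sub>M M i"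
  unfolding table_def by (rule measurable_component_singleton[of "(i, k)" _ "\<lambda>j. M (fst j)", simplified]) auto

lemma measurable_Omega_component: "i \<in> {1..n} \<Longrightarrow> (\<lambda>x. x i) \<in> Omega n M \<rightarrow>\<^sub>M M i"
  unfolding Omega_def by (rule measurable_component_singleton)

lemma measurable_current[measurable]: "current n \<in> table \<rightarrow>\<^sub>M Omega n M"
  unfolding current_def[abs_def] Omega_def
  by (intro measurable_restrict measurable_cell)

lemma measurable_advance[measurable]: "advance n V \<in> table \<rightarrow>\<^sub>M table"
  unfolding advance_def[abs_def]
  by (subst (2) table_def, intro measurable_restrict) (auto intro!: measurable_cell)

section \<open>Separating the top cells of a set of variables from the rest of the table\<close>

lemma measurable_glue:
  assumes "V \<subseteq> {1..n}"
  shows "(\<lambda>(y, Y). glue n V y Y) \<in> PiM V M \<Otimes>\<^sub>M table \<rightarrow>\<^sub>M table"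
proof -
  let ?P = "PiM V M \<Otimes>\<^sub>M table"
  have "(\<lambda>z. glue n V (fst z) (snd z)) \<in> ?P \<rightarrow>\<^sub>M PiM ({1..n} \<times> UNIV) (\<lambda>j. M (fst j))"
    unfolding glue_def
  proof (intro measurable_restrict)
    fix j :: "nat \<times> nat" assume j: "j \<in> {1..n} \<times> UNIV"
    then have cell: "(\<lambda>z. snd z (fst j, k)) \<in> ?P \<rightarrow>\<^sub>M M (fst j)" for k
      by (intro measurable_compose[OF measurable_snd] measurable_cell) auto
    show "(\<lambda>z. if fst j \<in> V then case snd j of 0 \<Rightarrow> fst z (fst j) | Suc k \<Rightarrow> snd z (fst j, k)
        else snd z j) \<in> ?P \<rightarrow>\<^sub>M M (fst j)"
    proof (cases "fst j \<in> V")
      case True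
      then have "(\<lambda>z. fst z (fst j)) \<in> ?P \<rightarrow>\<^sub>M M (fst j)"
        by (intro measurable_compose[OF measurable_fst] measurable_component_singleton)
      with True cell show ?thesis by (cases "snd j") auto
    next
      case False
      with cell[of "snd j"] show ?thesis by simp
    qed
  qed
  then show ?thesis by (simp only: table_def split_beta')
qed

text \<open>Gluing only relabels independent coordinates: each cell of the glued table copies a
  source coordinate of its own, which has the same law. Finite cylinders determine the product
  measure, so it is enough to compare both sides on these.\<close>

lemma distr_glue:
  assumes V: "V \<subseteq> {1..n}"
  shows "distr (PiM V M \<Otimes>\<^sub>M table) table (\<lambda>(y, Y). glue n V y Y) = table" (is "distr ?P _ ?g = _")
proof -
  let ?I = "{1..n} \<times> (UNIV :: nat set)" and ?N = "\<lambda>j :: nat \<times> nat. M (fst j)"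
  interpret V: prob_space "PiM V M" by (rule prob_space_PiM_vars[OF V])
  interpret P: pair_prob_space "PiM V M" table ..
  note g = measurable_glue[OF V]
  have "PiM ?I ?N = distr ?P table ?g"
  proof (rule measure_eqI_PiM_infinite)
    show "sets (PiM ?I ?N) = sets (PiM ?I ?N)" "sets (distr ?P table ?g) = sets (PiM ?I ?N)"
      by (simp_all add: table_def)
    show "finite_measure (PiM ?I ?N)"
      using table.finite_measure_axioms by (simp add: table_def)
  next
    fix A :: "nat \<times> nat \<Rightarrow> 'a set" and J
    assume J: "finite J" "J \<subseteq> ?I" and A: "\<And>j. j \<in> J \<Longrightarrow> A j \<in> sets (M (fst j))"
    \<comment> \<open>\<open>J0\<close> holds the constrained cells that are read from
      \<open>y\<close>, \<open>J1\<close> those read from \<open>Y\<close>; \<open>\<phi>\<close>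
      sends a cell of \<open>J1\<close> to the cell of \<open>Y\<close> that it copies. The cylinder
      therefore pulls back to the rectangle \<open>?E0 \<times> ?E1\<close>.\<close>
    define J0 where "J0 = {j \<in> J. fst j \<in> V \<and> snd j = 0}"
    define J1 where "J1 = J - J0"
    define \<phi> :: "nat \<times> nat \<Rightarrow> nat \<times> nat"
      where "\<phi> j = (fst j, if fst j \<in> V then snd j - 1 else snd j)" for j
    have inj0: "inj_on fst J0" and inj1: "inj_on \<phi> J1"
      by (auto simp: inj_on_def J0_def J1_def \<phi>_def split: if_splits)
    define A0 where "A0 i = A (i, 0)" for i
    define A1 where "A1 j = A (the_inv_into J1 \<phi> j)" for j
    have A1: "A1 (\<phi> j) = A j" if "j \<in> J1" for j
      using that inj1 by (simp add: A1_def the_inv_into_f_f)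
    let ?E0 = "prod_emb V M (fst ` J0) (PiE (fst ` J0) A0)"
    let ?E1 = "prod_emb ?I ?N (\<phi> ` J1) (PiE (\<phi> ` J1) A1)"
    have fin: "finite J0" "finite J1" using J by (auto simp: J0_def J1_def)
    have sets0: "A0 i \<in> sets (M i)" if "i \<in> fst ` J0" for i
      using that A by (auto simp: A0_def J0_def)
    have sets1: "A1 j \<in> sets (M (fst j))" if "j \<in> \<phi> ` J1" for j
      using that A by (auto simp: A1 J1_def) (auto simp: \<phi>_def)
    have sub0: "fst ` J0 \<subseteq> V" and sub1: "\<phi> ` J1 \<subseteq> ?I"
      using J V by (auto simp: J0_def J1_def \<phi>_def)
    have mem: "glue n V y Y \<in> prod_emb ?I ?N J (PiE J A) \<longleftrightarrow> y \<in> ?E0 \<and> Y \<in> ?E1"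
      if y: "y \<in> space (PiM V M)" and Y: "Y \<in> space table" for y Y
    proof -
      have "glue n V y Y \<in> space table"
        using measurable_space[OF g, of "(y, Y)"] y Y by (simp add: space_pair_measure)
      then have "glue n V y Y \<in> prod_emb ?I ?N J (PiE J A) \<longleftrightarrow> (\<forall>j\<in>J. glue n V y Y j \<in> A j)"
        by (auto simp: prod_emb_iff table_def space_PiM PiE_iff)
      also have "\<dots> \<longleftrightarrow> (\<forall>j\<in>J0. glue n V y Y j \<in> A j) \<and> (\<forall>j\<in>J1. glue n V y Y j \<in> A j)"
        by (auto simp: J1_def J0_def)
      also have "(\<forall>j\<in>J0. glue n V y Y j \<in> A j) \<longleftrightarrow> (\<forall>i\<in>fst ` J0. y i \<in> A0 i)"
        using J by (auto simp: glue_def A0_def J0_def)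
      also have "(\<forall>j\<in>J1. glue n V y Y j \<in> A j) \<longleftrightarrow> (\<forall>j\<in>J1. Y (\<phi> j) \<in> A1 (\<phi> j))"
        using J by (intro ball_cong refl)
          (auto simp: A1, auto simp: glue_def \<phi>_def J1_def J0_def split: nat.splits)
      also have "(\<forall>i\<in>fst ` J0. y i \<in> A0 i) \<longleftrightarrow> y \<in> ?E0"
        using y sub0 by (auto simp: prod_emb_iff space_PiM PiE_iff)
      also have "(\<forall>j\<in>J1. Y (\<phi> j) \<in> A1 (\<phi> j)) \<longleftrightarrow> Y \<in> ?E1"
        using Y sub1 by (auto simp: prod_emb_iff table_def space_PiM PiE_iff)
      finally show ?thesis .
    qed
    have E0: "?E0 \<in> sets (PiM V M)" and E1: "?E1 \<in> sets table"
      using fin sub0 sub1 sets0 sets1 unfolding table_def by (auto intro!: sets_PiM_I)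
    have "?g -` prod_emb ?I ?N J (PiE J A) \<inter> space ?P = ?E0 \<times> ?E1"
      using mem sets.sets_into_space[OF E0] sets.sets_into_space[OF E1]
      unfolding space_pair_measure by fast
    moreover have "prod_emb ?I ?N J (PiE J A) \<in> sets table"
      using J A unfolding table_def by (intro sets_PiM_I) auto
    ultimately have "emeasure (distr ?P table ?g) (prod_emb ?I ?N J (PiE J A)) = emeasure ?P (?E0 \<times> ?E1)"
      using g by (simp add: emeasure_distr)
    also have "\<dots> = emeasure (PiM V M) ?E0 * emeasure table ?E1"
      using E0 E1 by (rule table.emeasure_pair_measure_Times)
    also have "emeasure (PiM V M) ?E0 = (\<Prod>i\<in>fst ` J0. emeasure (M i) (A0 i))"
      using V fin sub0 sets0 by (intro emeasure_PiM_emb prob_space_variable) auto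
    also have "\<dots> = (\<Prod>j\<in>J0. emeasure (M (fst j)) (A j))"
      unfolding prod.reindex[OF inj0] by (intro prod.cong) (auto simp: A0_def J0_def)
    also have "emeasure table ?E1 = (\<Prod>j\<in>\<phi> ` J1. emeasure (M (fst j)) (A1 j))"
      unfolding table_def using fin sub1 sets1
      by (intro emeasure_PiM_emb prob_space_variable) auto
    also have "\<dots> = (\<Prod>j\<in>J1. emeasure (M (fst j)) (A j))"
      unfolding prod.reindex[OF inj1] by (intro prod.cong) (auto simp: A1, simp add: \<phi>_def)
    also have "(\<Prod>j\<in>J0. emeasure (M (fst j)) (A j)) * (\<Prod>j\<in>J1. emeasure (M (fst j)) (A j)) =
        (\<Prod>j\<in>J. emeasure (M (fst j)) (A j))"
      unfolding J1_def using J
      by (subst prod.subset_diff[of J0 J]) (auto simp: J0_def mult.commute)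
    also have "\<dots> = emeasure (PiM ?I ?N) (prod_emb ?I ?N J (PiE J A))"
      using J A by (intro emeasure_PiM_emb[symmetric] prob_space_variable) auto
    finally show "emeasure (PiM ?I ?N) (prod_emb ?I ?N J (PiE J A)) =
        emeasure (distr ?P table ?g) (prod_emb ?I ?N J (PiE J A))" ..
  qed
  then show ?thesis by (simp add: table_def)
qed

lemma nn_integral_glue:
  assumes V: "V \<subseteq> {1..n}" and f: "f \<in> borel_measurable table"
  shows "(\<integral>\<^sup>+Y. f Y \<partial>table) = (\<integral>\<^sup>+y. \<integral>\<^sup>+Y. f (glue n V y Y) \<partial>table \<partial>PiM V M)"
proof -
  note [measurable] = measurable_glue[OF V] f
  have "(\<integral>\<^sup>+Y. f Y \<partial>table) = (\<integral>\<^sup>+z. f (case z of (y, Y) \<Rightarrow> glue n V y Y) \<partial>(PiM V M \<Otimes>\<^sub>M table))"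
    by (subst distr_glue[OF V, symmetric], subst nn_integral_distr) auto
  also have "\<dots> = (\<integral>\<^sup>+y. \<integral>\<^sup>+Y. f (glue n V y Y) \<partial>table \<partial>PiM V M)"
    by (subst table.nn_integral_fst[symmetric]) auto
  finally show ?thesis .
qed

lemma current_in_space: "Y \<in> space table \<Longrightarrow> current n Y \<in> space (Omega n M)"
  by (rule measurable_space[OF measurable_current])

lemma advance_in_space: "Y \<in> space table \<Longrightarrow> advance n V Y \<in> space table"
  by (rule measurable_space[OF measurable_advance])

lemma glue_in_space:
  "V \<subseteq> {1..n} \<Longrightarrow> y \<in> space (PiM V M) \<Longrightarrow> Y \<in> space table \<Longrightarrow> glue n V y Y \<in> space table"
  using measurable_space[OF measurable_glue, of V "(y, Y)"] by (simp add: space_pair_measure)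

lemma table_extensional: "Y \<in> space table \<Longrightarrow> Y \<in> extensional ({1..n} \<times> UNIV)"
  by (auto simp: table_def space_PiM PiE_def)

lemma advance_glue:
  assumes "Y \<in> space table"
  shows "advance n V (glue n V y Y) = Y"
  using table_extensional[OF assms] by (auto simp: advance_def glue_def fun_eq_iff extensional_def)

lemma current_glue_all:
  "x \<in> space (Omega n M) \<Longrightarrow> current n (glue n {1..n} x Y) = x"
  by (auto simp: current_def glue_def fun_eq_iff Omega_def space_PiM PiE_iff extensional_def)

lemma distr_current: "distr table (Omega n M) (current n) = Omega n M"
proof -
  have "distr table (Omega n M) (\<lambda>Y. \<lambda>i\<in>{1..n}. Y (i, 0)) = Omega n M"
    using distr_PiM_reindex[of "{1..n} \<times> UNIV" "\<lambda>j. M (fst j)" "\<lambda>i. (i, 0)" "{1..n}"]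
    by (auto simp: table_def Omega_def inj_on_def prob_space_variable)
  then show ?thesis by (simp add: current_def[abs_def])
qed

text \<open>The checked variables and the cells that remain after the advance are disjoint.\<close>

lemma measure_check_advance:
  assumes B: "is_event n M B" and S: "S \<in> sets table"
  shows "measure table {Y \<in> space table. current n Y \<in> outcomes B \<and> advance n (vars B) Y \<in> S} =
    measure (Omega n M) (outcomes B) * measure table S"
proof -
  let ?V = "vars B"
  from B have V: "?V \<subseteq> {1..n}" and oB[measurable]: "outcomes B \<in> sets (Omega n M)"
    by (auto simp: is_event_def)
  interpret V: prob_space "PiM ?V M" by (rule prob_space_PiM_vars[OF V])
  note [measurable] = S
  \<comment> \<open>The coordinates in \<open>?V\<close> decide whether \<open>B\<close> holds;
    \<open>x0\<close> fills in the others, which turns \<open>B\<close> into an event on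
    \<open>PiM ?V M\<close>.\<close>
  obtain x0 where x0: "x0 \<in> space (Omega n M)" using Omega.not_empty by auto
  define ext where "ext y = (\<lambda>i\<in>{1..n}. if i \<in> ?V then y i else x0 i)" for y
  have ext[measurable]: "ext \<in> PiM ?V M \<rightarrow>\<^sub>M Omega n M"
    unfolding ext_def[abs_def] Omega_def
  proof (intro measurable_restrict)
    fix i assume "i \<in> {1..n}"
    then show "(\<lambda>y. if i \<in> ?V then y i else x0 i) \<in> PiM ?V M \<rightarrow>\<^sub>M M i"
      using x0 by (cases "i \<in> ?V") (auto simp: Omega_def space_PiM PiE_iff intro: measurable_component_singleton)
  qed
  have cur: "current n (glue n ?V y Y) \<in> outcomes B \<longleftrightarrow> ext y \<in> outcomes B"
    if "y \<in> space (PiM ?V M)" "Y \<in> space table" for y Y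
  proof -
    have "current n (glue n ?V y Y) \<in> space (Omega n M)" "ext y \<in> space (Omega n M)"
      using that V by (auto intro!: current_in_space glue_in_space measurable_space[OF ext])
    moreover have "\<forall>i\<in>?V. current n (glue n ?V y Y) i = ext y i"
      using V by (auto simp: current_def glue_def ext_def)
    ultimately show ?thesis using B unfolding is_event_def by blast
  qed
  \<comment> \<open>Kept general in the target set: besides the given one it is applied to
    \<open>space table\<close>, which identifies the first factor as the probability of
    \<open>B\<close> in \<open>Omega n M\<close>.\<close>
  have product: "emeasure table {Y \<in> space table. current n Y \<in> outcomes B \<and> advance n ?V Y \<in> S} =
      emeasure (PiM ?V M) {y \<in> space (PiM ?V M). ext y \<in> outcomes B} * emeasure table S"
    if [measurable]: "S \<in> sets table" for S
  proof -
    have "emeasure table {Y \<in> space table. current n Y \<in> outcomes B \<and> advance n ?V Y \<in> S} =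
      (\<integral>\<^sup>+Y. indicator {Y \<in> space table. current n Y \<in> outcomes B \<and> advance n ?V Y \<in> S} Y \<partial>table)"
      by (subst nn_integral_indicator) measurable
    also have "\<dots> = (\<integral>\<^sup>+y. \<integral>\<^sup>+Y. indicator {Y \<in> space table. current n Y \<in> outcomes B \<and> advance n ?V Y \<in> S}
        (glue n ?V y Y) \<partial>table \<partial>PiM ?V M)"
      by (rule nn_integral_glue[OF V]) measurable
    also have "\<dots> = (\<integral>\<^sup>+y. \<integral>\<^sup>+Y. indicator {y \<in> space (PiM ?V M). ext y \<in> outcomes B} y * indicator S Y
        \<partial>table \<partial>PiM ?V M)"
      by (intro nn_integral_cong) (auto simp: indicator_def cur advance_glue glue_in_space[OF V])
    also have "\<dots> = emeasure (PiM ?V M) {y \<in> space (PiM ?V M). ext y \<in> outcomes B} * emeasure table S"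
      by (simp add: nn_integral_cmult nn_integral_multc)
    finally show ?thesis .
  qed
  have "emeasure (PiM ?V M) {y \<in> space (PiM ?V M). ext y \<in> outcomes B} =
      emeasure table {Y \<in> space table. current n Y \<in> outcomes B}"
    using product[of "space table"]
    by (simp add: table.emeasure_space_1 advance_in_space cong: conj_cong)
  also have "\<dots> = emeasure (distr table (Omega n M) (current n)) (outcomes B)"
    by (subst emeasure_distr) (auto intro!: arg_cong2[where f=emeasure])
  also have "\<dots> = emeasure (Omega n M) (outcomes B)"
    by (simp only: distr_current)
  finally show ?thesis
    using product[OF S]
    by (simp add: measure_def enn2real_mult)
qed

end

section \<open>Layerings\<close>

text \<open>The head of a list of layers is the layer that is executed last.\<close>

primrec after :: "nat \<Rightarrow> 'a event set list \<Rightarrow> (nat \<times> nat \<Rightarrow> 'a) \<Rightarrow> nat \<times> nat \<Rightarrow> 'a" where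
  "after n [] Y = Y"
| "after n (I # L) Y = advance n (\<Union>(vars ` I)) (after n L Y)"

primrec valid :: "nat \<Rightarrow> 'a event set list \<Rightarrow> (nat \<times> nat \<Rightarrow> 'a) \<Rightarrow> bool" where
  "valid n [] Y \<longleftrightarrow> True"
| "valid n (I # L) Y \<longleftrightarrow> valid n L Y \<and> (\<forall>B\<in>I. current n (after n L Y) \<in> outcomes B)"

text \<open>With the disjointness in \<open>layerings\<close>, these are the stable set sequences
  known from the analysis of resampling algorithms. The recursion starts at the layer executed last,
  so a bound on that layer propagates backwards in time.\<close>

primrec stable :: "'a event set \<Rightarrow> 'a event set \<Rightarrow> 'a event set list \<Rightarrow> bool" where
  "stable \<B> N [] \<longleftrightarrow> True"
| "stable \<B> N (I # L) \<longleftrightarrow> I \<subseteq> N \<and> stable \<B> (\<Union>(neighbourhood \<B> ` I)) L"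

definition layerings :: "'a event set \<Rightarrow> nat \<Rightarrow> 'a event set list set" where
  "layerings \<B> T = {L. length L = T \<and> (\<forall>I\<in>set L. I \<subseteq> \<B> \<and> disjoint_family_on vars I)}"

text \<open>An event is counted once for its own layer and once for every later one.\<close>

primrec height :: "'a event set list \<Rightarrow> nat" where
  "height [] = 0"
| "height (I # L) = card I + height L + (\<Sum>J\<leftarrow>L. card J)"

lemma after_append: "after n (L @ L') Y = after n L (after n L' Y)"
  by (induction L) auto

lemma valid_append: "valid n (L @ L') Y \<longleftrightarrow> valid n L' Y \<and> valid n L (after n L' Y)"
  by (induction L) (auto simp: after_append)

lemma height_append:
  "height (L @ L') = height L + height L' + length L * (\<Sum>J\<leftarrow>L'. card J)"
  by (induction L) (auto simp: algebra_simps)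

lemma finite_layerings: "finite \<B> \<Longrightarrow> finite (layerings \<B> T)"
  by (rule finite_subset[OF _ finite_lists_length_eq[of "Pow \<B>" T]]) (auto simp: layerings_def)

lemma not_stableE:
  assumes "\<not> stable \<B> N L"
  obtains (top) I L' B where "L = I # L'" "B \<in> I" "B \<notin> N"
  | (inner) K J I L' B where "L = K @ J # I # L'" "B \<in> I" "B \<notin> \<Union>(neighbourhood \<B> ` J)"
  using assms
proof (induction L arbitrary: N thesis)
  case (Cons I L)
  show ?case
  proof (cases "I \<subseteq> N")
    case False
    then show ?thesis using Cons.prems(1) by blast
  next
    case True
    with Cons.prems(3) have "\<not> stable \<B> (\<Union>(neighbourhood \<B> ` I)) L" by simp
    then show ?thesis
    proof (rule Cons.IH[rotated 2])
      fix I' L' B assume "L = I' # L'" "B \<in> I'" "B \<notin> \<Union>(neighbourhood \<B> ` I)"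
      then show thesis using Cons.prems(2)[of "[]" I I' L' B] by simp
    next
      fix K J I' L' B assume "L = K @ J # I' # L'" "B \<in> I'" "B \<notin> \<Union>(neighbourhood \<B> ` J)"
      then show thesis using Cons.prems(2)[of "I # K" J I' L' B] by simp
    qed
  qed
qed simp

lemma advance_advance:
  assumes "V \<inter> W = {}"
  shows "advance n V (advance n W Y) = advance n (V \<union> W) Y"
  using assms by (auto simp: advance_def fun_eq_iff)

lemma current_advance_disjoint:
  "i \<notin> V \<Longrightarrow> current n (advance n V Y) i = current n Y i"
  by (auto simp: current_def advance_def)

lemma sum_Pow_power_card:
  fixes a :: real
  assumes "finite N"
  shows "(\<Sum>I\<in>Pow N. a ^ card I) = (1 + a) ^ card N"
  using prod_add[OF assms, of "\<lambda>_. a" "\<lambda>_. 1"] by (simp add: add.commute)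

context independent_variables
begin

lemma after_in_space: "Y \<in> space table \<Longrightarrow> after n L Y \<in> space table"
  by (induction L) (auto intro: advance_in_space)

lemma measurable_after[measurable]: "after n L \<in> table \<rightarrow>\<^sub>M table"
  by (induction L) auto

lemma advance_empty: "Y \<in> space table \<Longrightarrow> advance n {} Y = Y"
  using table_extensional[of Y] by (auto simp: advance_def fun_eq_iff extensional_def)

lemma is_event_cong:
  assumes "is_event n M B" "Y \<in> space table" "Z \<in> space table"
    and "\<And>i. i \<in> vars B \<Longrightarrow> current n Y i = current n Z i"
  shows "current n Y \<in> outcomes B \<longleftrightarrow> current n Z \<in> outcomes B"
  using assms current_in_space unfolding is_event_def by metis

lemma current_advance_event:
  assumes "is_event n M B" "Y \<in> space table" "vars B \<inter> V = {}"
  shows "current n (advance n V Y) \<in> outcomes B \<longleftrightarrow> current n Y \<in> outcomes B"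
  using assms by (intro is_event_cong advance_in_space current_advance_disjoint) auto

end

section \<open>The probability that a layering is legal, and the repair of unstable
  layerings\<close>

locale bad_events = independent_variables n M for n and M :: "nat \<Rightarrow> 'a measure" +
  fixes \<B> :: "'a event set"
  assumes finite_bad: "finite \<B>"
    and bad_event: "B \<in> \<B> \<Longrightarrow> is_event n M B"
begin

lemma measurable_bad: "B \<in> \<B> \<Longrightarrow> outcomes B \<in> sets (Omega n M)"
  using bad_event by (auto simp: is_event_def)

lemma layering_valid_sets:
  "\<forall>I\<in>set L. I \<subseteq> \<B> \<Longrightarrow> {Y \<in> space table. valid n L Y} \<in> sets table"
proof (induction L)
  case (Cons I L)
  have "I \<subseteq> \<B>" using Cons.prems by simp
  then have fin: "finite I" and out: "B \<in> I \<Longrightarrow> outcomes B \<in> sets (Omega n M)" for B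
    using finite_subset[OF _ finite_bad] measurable_bad by blast+
  have "{Y \<in> space table. current n (after n L Y) \<in> outcomes B} \<in> sets table" if "B \<in> I" for B
    using out[OF that] by measurable
  then have "{Y \<in> space table. \<forall>B\<in>I. current n (after n L Y) \<in> outcomes B} \<in> sets table"
    using fin by (rule sets.sets_Collect_finite_All)
  then show ?case using Cons by (auto intro: sets.sets_Collect_conj)
qed simp

text \<open>The events of a layer have disjoint variables, so popping the stacks of one does not
  disturb the checks of the others. They can be split off one at a time, each contributing a factor
  by \<open>measure_check_advance\<close>.\<close>

lemma measure_check_layer:
  assumes "I \<subseteq> \<B>" "disjoint_family_on vars I" "S \<in> sets table"
  shows "measure table {Y \<in> space table. (\<forall>B\<in>I. current n Y \<in> outcomes B) \<and>
      advance n (\<Union>(vars ` I)) Y \<in> S} = (\<Prod>B\<in>I. measure (Omega n M) (outcomes B)) * measure table S"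
proof -
  have "finite I" using assms(1) finite_bad by (rule finite_subset)
  then show ?thesis using assms
  proof (induction I arbitrary: S)
    case empty
    then have "{Y \<in> space table. advance n {} Y \<in> S} = S"
      using sets.sets_into_space[OF empty(3)] by (auto simp: advance_empty)
    then show ?case by simp
  next
    case (insert B I)
    let ?V = "\<Union>(vars ` I)"
    have B: "is_event n M B" using insert.prems bad_event by auto
    have disj: "vars C \<inter> vars B = {}" if "C \<in> I" for C
      using insert.prems(2) insert.hyps that by (auto simp: disjoint_family_on_def)
    have disj': "?V \<inter> vars B = {}" using disj by auto
    \<comment> \<open>What remains to happen after \<open>B\<close> has been checked and popped: the
      other checks of the layer, then \<open>S\<close>.\<close>
    define S' where "S' = {Y \<in> space table. (\<forall>B\<in>I. current n Y \<in> outcomes B) \<and> advance n ?V Y \<in> S}"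
    have "{Y \<in> space table. \<forall>B\<in>I. current n Y \<in> outcomes B} \<in> sets table"
      using layering_valid_sets[of "[I]"] insert.prems by simp
    moreover have "{Y \<in> space table. advance n ?V Y \<in> S} \<in> sets table"
      using insert.prems(3) by measurable
    ultimately have S': "S' \<in> sets table"
      by (auto simp: S'_def intro: sets.sets_Collect_conj)
    have "{Y \<in> space table. (\<forall>B\<in>insert B I. current n Y \<in> outcomes B) \<and>
        advance n (\<Union>(vars ` insert B I)) Y \<in> S} =
      {Y \<in> space table. current n Y \<in> outcomes B \<and> advance n (vars B) Y \<in> S'}"
      using insert.prems(1) bad_event disj
      by (auto simp: S'_def advance_in_space advance_advance[OF disj'] current_advance_event Un_commute subset_iff)
    then have "measure table {Y \<in> space table. (\<forall>B\<in>insert B I. current n Y \<in> outcomes B) \<and>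
        advance n (\<Union>(vars ` insert B I)) Y \<in> S} = measure (Omega n M) (outcomes B) * measure table S'"
      by (simp only: measure_check_advance[OF B S'])
    also have "measure table S' = (\<Prod>B\<in>I. measure (Omega n M) (outcomes B)) * measure table S"
      unfolding S'_def using insert.prems
      by (intro insert.IH) (auto intro: disjoint_family_on_mono)
    finally show ?case using insert.hyps by simp
  qed
qed

definition weight :: "'a event set list \<Rightarrow> real" where
  "weight L = (\<Prod>I\<leftarrow>L. \<Prod>B\<in>I. measure (Omega n M) (outcomes B))"

text \<open>The table left behind by a legal layering is fresh: validity inspects only cells that
  are then popped. The induction removes the layer executed last and absorbs its check into the
  target set, hence the arbitrary \<open>S\<close>.\<close>

lemma measure_valid:
  assumes "L \<in> layerings \<B> T" "S \<in> sets table"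
  shows "measure table {Y \<in> space table. valid n L Y \<and> after n L Y \<in> S} = weight L * measure table S"
  using assms
proof (induction L arbitrary: S T)
  case Nil
  then have "{Y \<in> space table. Y \<in> S} = S"
    using sets.sets_into_space by auto
  then show ?case by (simp add: weight_def)
next
  case (Cons I L)
  then have L: "L \<in> layerings \<B> (length L)" and I: "I \<subseteq> \<B>" "disjoint_family_on vars I"
    by (auto simp: layerings_def)
  note [measurable] = Cons.prems(2)
  define S' where "S' = {Y \<in> space table. (\<forall>B\<in>I. current n Y \<in> outcomes B) \<and>
      advance n (\<Union>(vars ` I)) Y \<in> S}"
  have "{Y \<in> space table. \<forall>B\<in>I. current n Y \<in> outcomes B} \<in> sets table"
    using layering_valid_sets[of "[I]"] I by simp
  moreover have "{Y \<in> space table. advance n (\<Union>(vars ` I)) Y \<in> S} \<in> sets table"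
    by measurable
  ultimately have S': "S' \<in> sets table"
    by (auto simp: S'_def intro: sets.sets_Collect_conj)
  have "{Y \<in> space table. valid n (I # L) Y \<and> after n (I # L) Y \<in> S} =
      {Y \<in> space table. valid n L Y \<and> after n L Y \<in> S'}"
    by (auto simp: S'_def after_in_space)
  then have "measure table {Y \<in> space table. valid n (I # L) Y \<and> after n (I # L) Y \<in> S} =
      weight L * measure table S'"
    by (simp only: Cons.IH[OF L S'])
  also have "measure table S' = (\<Prod>B\<in>I. measure (Omega n M) (outcomes B)) * measure table S"
    unfolding S'_def using I Cons.prems(2) by (rule measure_check_layer)
  finally show ?case by (simp add: weight_def)
qed

text \<open>The events of an earlier layer that have no neighbour in the next layer can be executed
  together with that next layer, and those of the last layer that do not touch \<open>A\<close> can be dropped.\<close>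

lemma lower_layering:
  assumes L: "L \<in> layerings \<B> T" "valid n L Y" and Y: "Y \<in> space table"
    and A: "is_event n M A" "current n (after n L Y) \<in> outcomes A"
    and unstable: "\<not> stable \<B> (neighbourhood \<B> A) L"
  obtains L' where "L' \<in> layerings \<B> T" "valid n L' Y" "current n (after n L' Y) \<in> outcomes A"
    "height L' < height L"
  using unstable
proof (cases rule: not_stableE)
  case (top I K B)
  have I: "I \<subseteq> \<B>" "disjoint_family_on vars I" using L top by (auto simp: layerings_def)
  then have fin: "finite I" using finite_bad finite_subset by blast
  let ?Z = "after n K Y" and ?V = "\<Union>(vars ` (I - {B}))"
  have Z: "?Z \<in> space table" using Y by (rule after_in_space)
  have BA: "vars A \<inter> vars B = {}" and BV: "vars B \<inter> ?V = {}"
    using top I by (auto simp: neighbourhood_def dependent_def disjoint_family_on_def)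
  have "\<Union>(vars ` I) = vars B \<union> ?V" using \<open>B \<in> I\<close> by auto
  then have "after n L Y = advance n (vars B) (advance n ?V ?Z)"
    using top(1) by (simp add: advance_advance[OF BV])
  then have "current n (after n ((I - {B}) # K) Y) \<in> outcomes A"
    using A BA Z by (simp add: current_advance_event advance_in_space)
  moreover have "(I - {B}) # K \<in> layerings \<B> T"
    using L top(1) by (auto simp: layerings_def intro: disjoint_family_on_mono)
  moreover have "valid n ((I - {B}) # K) Y" using L top(1) by auto
  moreover have "height ((I - {B}) # K) < height L"
    using top(1) fin \<open>B \<in> I\<close> card_Diff1_less[of I B] by simp
  ultimately show thesis using that by blast
next
  case (inner K J I L' B)
  have I: "I \<subseteq> \<B>" "disjoint_family_on vars I" and J: "J \<subseteq> \<B>" "disjoint_family_on vars J"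
    using L inner by (auto simp: layerings_def)
  then have fin: "finite I" "finite J" using finite_bad finite_subset by blast+
  have B: "B \<in> \<B>" using I inner by auto
  let ?Z = "after n L' Y" and ?V = "\<Union>(vars ` (I - {B}))" and ?W = "\<Union>(vars ` J)"
  let ?L = "K @ insert B J # (I - {B}) # L'"
  have Z: "?Z \<in> space table" using Y by (rule after_in_space)
  have BJ: "vars C \<inter> vars B = {}" if "C \<in> J" for C
    using inner(3) B that by (auto simp: neighbourhood_def dependent_def)
  then have BW: "?W \<inter> vars B = {}" by auto
  have BI: "vars B \<inter> vars C = {}" if "C \<in> I - {B}" for C
    using I(2) that inner(2) by (auto simp: disjoint_family_on_def)
  then have BV: "vars B \<inter> ?V = {}" by auto
  have VI: "\<Union>(vars ` I) = vars B \<union> ?V" using \<open>B \<in> I\<close> by auto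
  then have advance_I: "advance n (\<Union>(vars ` I)) ?Z = advance n (vars B) (advance n ?V ?Z)"
    by (simp add: advance_advance[OF BV])
  \<comment> \<open>Postponing \<open>B\<close> to the next layer leaves the same table behind, so
    the layers in \<open>K\<close> and the final check of \<open>A\<close> are unaffected.\<close>
  have after_eq: "after n (J # I # L') Y = after n (insert B J # (I - {B}) # L') Y"
    by (simp add: VI advance_advance[OF BV, symmetric] advance_advance[OF BW] Un_commute del: UN_simps)
  have "valid n (J # I # L') Y"
    using L(2) inner(1) by (simp only: valid_append)
  then have valid: "valid n L' Y" "\<And>C. C \<in> I \<Longrightarrow> current n ?Z \<in> outcomes C"
    "\<And>C. C \<in> J \<Longrightarrow> current n (advance n (vars B) (advance n ?V ?Z)) \<in> outcomes C"
    by (auto simp: advance_I)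
  \<comment> \<open>\<open>B\<close> still holds when \<open>J\<close> is due, because the rest of
    \<open>I\<close> does not touch its variables; and the events of \<open>J\<close> do not see
    whether \<open>B\<close> has been popped.\<close>
  have "current n (advance n ?V ?Z) \<in> outcomes B"
    using current_advance_event[OF bad_event[OF B] Z BV] valid(2) inner(2) by blast
  moreover have "current n (advance n ?V ?Z) \<in> outcomes C" if "C \<in> J" for C
    using valid(3)[OF that] current_advance_event[OF _ _ BJ[OF that]] bad_event J that Z
    by (auto simp: advance_in_space subset_iff)
  ultimately have "valid n (insert B J # (I - {B}) # L') Y"
    using valid by auto
  then have "valid n ?L Y"
    using L(2) inner(1) by (simp only: valid_append after_eq)
  moreover have "current n (after n ?L Y) \<in> outcomes A"
    using A(2) inner(1) by (simp only: after_append after_eq)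
  moreover have "disjoint_family_on vars (insert B J)"
    using J(2) BJ unfolding disjoint_family_on_def by blast
  then have "?L \<in> layerings \<B> T"
    using L(1) inner(1) B by (auto simp: layerings_def intro: disjoint_family_on_mono)
  \<comment> \<open>\<open>B\<close> moves one layer closer to the end and so loses at least one
    count. The bound on \<open>card (insert B J)\<close> also covers \<open>B \<in> J\<close>, which
    can occur when \<open>vars B\<close> is empty.\<close>
  moreover have "height ?L < height L"
  proof -
    have c: "card (I - {B}) + 1 = card I"
      using fin inner(2) by (metis Suc_eq_plus1 card_Suc_Diff1)
    have i: "card (insert B J) \<le> card J + 1" using fin by (simp add: card_insert_if)
    have "length K * (card (insert B J) + (card (I - {B}) + s)) \<le> length K * (card J + (card I + s))" for s
      using i c by (intro mult_left_mono) auto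
    from this[of "\<Sum>J\<leftarrow>L'. card J"] show ?thesis
      using i c unfolding inner(1) height_append height.simps list.map sum_list.Cons by linarith
  qed
  ultimately show thesis using that by blast
qed

end

section \<open>Counting stable layerings\<close>

context bad_events
begin

text \<open>All legal layerings are allowed, whatever a rule would select; this makes one bound
  serve every selection rule.\<close>

definition good :: "nat \<Rightarrow> (nat \<Rightarrow> 'a) set \<Rightarrow> (nat \<times> nat \<Rightarrow> 'a) set" where
  "good T E = {Y \<in> space table. \<exists>L\<in>layerings \<B> T. valid n L Y \<and> current n (after n L Y) \<in> E}"

lemma sets_good[measurable]:
  assumes [measurable]: "E \<in> sets (Omega n M)"
  shows "good T E \<in> sets table"
  unfolding good_def
proof (intro sets.sets_Collect_finite_Ex sets.sets_Collect_conj finite_layerings finite_bad)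
  fix L assume "L \<in> layerings \<B> T"
  then show "{Y \<in> space table. valid n L Y} \<in> sets table"
    by (intro layering_valid_sets) (auto simp: layerings_def)
  show "{Y \<in> space table. current n (after n L Y) \<in> E} \<in> sets table" by measurable
qed

text \<open>A layering of least height cannot be lowered. The minimum is taken over layerings that
  reach the union, and \<open>k\<close> is read off afterwards: lowering preserves
  \<open>A k\<close> but may change the final configuration and make an earlier event the first to
  hold.\<close>

lemma good_stable:
  fixes A :: "nat \<Rightarrow> 'a event"
  assumes A: "\<And>k. k < m \<Longrightarrow> is_event n M (A k)"
    and Y: "Y \<in> good T (\<Union>k\<in>{0..<m}. outcomes (A k))"
  obtains k L where "k < m" "L \<in> layerings \<B> T" "stable \<B> (neighbourhood \<B> (A k)) L" "valid n L Y"
    "current n (after n L Y) \<in> disjointed (\<lambda>k. outcomes (A k)) k"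
proof -
  let ?P = "\<lambda>L. L \<in> layerings \<B> T \<and> valid n L Y \<and> current n (after n L Y) \<in> (\<Union>k\<in>{0..<m}. outcomes (A k))"
  from Y obtain L0 where "?P L0" by (auto simp: good_def)
  then obtain L where L: "?P L" and min: "\<And>L'. ?P L' \<Longrightarrow> height L \<le> height L'"
    using ex_has_least_nat[of ?P L0 height] by blast
  have "current n (after n L Y) \<in> (\<Union>k\<in>{0..<m}. disjointed (\<lambda>k. outcomes (A k)) k)"
    using L by (simp only: finite_UN_disjointed_eq)
  then obtain k where k: "k < m" "current n (after n L Y) \<in> disjointed (\<lambda>k. outcomes (A k)) k"
    by auto
  then have "current n (after n L Y) \<in> outcomes (A k)"
    by (auto simp: disjointed_def)
  moreover have "Y \<in> space table" using Y by (simp add: good_def)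
  ultimately have "stable \<B> (neighbourhood \<B> (A k)) L"
    using lower_layering[of L T Y "A k"] A[OF k(1)] L min k(1)
    by (metis (no_types, lifting) UN_I atLeast0LessThan lessThan_iff not_le)
  with k L show thesis using that by blast
qed

lemma weight_nonneg: "0 \<le> weight L"
  unfolding weight_def by (induction L) (auto intro!: mult_nonneg_nonneg prod_nonneg)

text \<open>If the last layer is \<open>I\<close>, it contributes at most \<open>p ^ card I\<close>,
  and the earlier layers, confined to at most \<open>d * card I\<close> events, at most
  \<open>(1 + exp 1 * p) ^ (d * card I)\<close> by induction. By \<open>lll\<close> the product is
  at most \<open>(exp 1 * p) ^ card I\<close>, and the sum over all subsets of \<open>N\<close> is
  binomial.\<close>

lemma sum_stable_weight_le:
  fixes p :: real and d :: nat
  assumes p: "0 \<le> p" "\<And>B. B \<in> \<B> \<Longrightarrow> measure (Omega n M) (outcomes B) \<le> p"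
    and d: "\<And>B. B \<in> \<B> \<Longrightarrow> card (neighbourhood \<B> B) \<le> d"
    and epd: "exp 1 * p * real d \<le> 1"
    and N: "N \<subseteq> \<B>"
  shows "(\<Sum>L | L \<in> layerings \<B> T \<and> stable \<B> N L. weight L) \<le> (1 + exp 1 * p) ^ card N"
  using N
proof (induction T arbitrary: N)
  case 0
  have "{L. L \<in> layerings \<B> 0 \<and> stable \<B> N L} = {[]}"
    by (auto simp: layerings_def)
  then show ?case using p by (simp add: weight_def)
next
  case (Suc T)
  have finN: "finite N" using Suc.prems finite_bad by (rule finite_subset)
  let ?N = "\<lambda>I. \<Union>(neighbourhood \<B> ` I)" and ?S = "\<lambda>N T. {L. L \<in> layerings \<B> T \<and> stable \<B> N L}"
  let ?X = "SIGMA I:Pow N. ?S (?N I) T" and ?c = "\<lambda>(I, L). I # L"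
  have finS: "finite (?S N T)" for N T
    using finite_layerings[OF finite_bad] by simp
  \<comment> \<open>The only use of the criterion: \<open>exp 1 * p\<close> is a solution \<mu> of
    \<open>p * (1 + \<mu>) ^ d \<le> \<mu>\<close>, because
    \<open>1 + x \<le> exp x\<close>.\<close>
  have "p * (1 + exp 1 * p) ^ d \<le> p * exp (exp 1 * p) ^ d"
    using p by (intro mult_left_mono power_mono) (auto simp: add.commute exp_ge_add_one_self)
  also have "\<dots> = p * exp (exp 1 * p * real d)"
    by (simp add: exp_of_nat_mult[symmetric] mult.commute)
  also have "\<dots> \<le> p * exp 1"
    using p epd by (intro mult_left_mono) auto
  finally have lll: "p * (1 + exp 1 * p) ^ d \<le> exp 1 * p" by (simp add: mult.commute)
  have layer: "(\<Sum>L\<in>?S (?N I) T. (\<Prod>B\<in>I. measure (Omega n M) (outcomes B)) * weight L) \<le> (exp 1 * p) ^ card I"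
    if "I \<subseteq> N" for I
  proof -
    have I: "I \<subseteq> \<B>" "finite I" using that Suc.prems finN finite_subset by auto
    have "card (?N I) \<le> (\<Sum>B\<in>I. card (neighbourhood \<B> B))"
      by (rule card_UN_le[OF I(2)])
    also have "\<dots> \<le> d * card I"
      using sum_bounded_above[of I "\<lambda>B. card (neighbourhood \<B> B)" d] d I(1) by (auto simp: mult.commute)
    finally have card: "card (?N I) \<le> d * card I" .
    have "(\<Prod>B\<in>I. measure (Omega n M) (outcomes B)) \<le> (\<Prod>B\<in>I. p)"
      using p I by (intro prod_mono) auto
    then have prod: "(\<Prod>B\<in>I. measure (Omega n M) (outcomes B)) \<le> p ^ card I" by simp
    have "?N I \<subseteq> \<B>" by (auto simp: neighbourhood_def)
    then have "(\<Sum>L\<in>?S (?N I) T. weight L) \<le> (1 + exp 1 * p) ^ card (?N I)"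
      by (rule Suc.IH)
    also have "\<dots> \<le> (1 + exp 1 * p) ^ (d * card I)"
      using p card by (intro power_increasing) auto
    finally have "(\<Prod>B\<in>I. measure (Omega n M) (outcomes B)) * (\<Sum>L\<in>?S (?N I) T. weight L) \<le>
        p ^ card I * (1 + exp 1 * p) ^ (d * card I)"
      using prod p by (intro mult_mono) (auto intro!: sum_nonneg weight_nonneg)
    also have "\<dots> = (p * (1 + exp 1 * p) ^ d) ^ card I"
      by (simp add: power_mult_distrib power_mult)
    also have "\<dots> \<le> (exp 1 * p) ^ card I"
      using lll p by (intro power_mono) auto
    finally show ?thesis by (simp add: sum_distrib_left)
  qed
  \<comment> \<open>The image also contains lists whose head is not a disjoint family. As weights
    are nonnegative, adding these only increases the sum and lets the head range over all of
    \<open>Pow N\<close>.\<close>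
  have "(\<Sum>L\<in>?S N (Suc T). weight L) \<le> (\<Sum>L\<in>?c ` ?X. weight L)"
  proof (intro sum_mono2)
    show "finite (?c ` ?X)"
      using finN finS by (intro finite_imageI finite_SigmaI) auto
    show "?S N (Suc T) \<subseteq> ?c ` ?X"
    proof
      fix L assume "L \<in> ?S N (Suc T)"
      then obtain I L' where "L = I # L'" "I \<subseteq> N" "L' \<in> ?S (?N I) T"
        by (cases L) (auto simp: layerings_def)
      then show "L \<in> ?c ` ?X" by (intro image_eqI[of _ _ "(I, L')"]) auto
    qed
  qed (rule weight_nonneg)
  also have "\<dots> = (\<Sum>z\<in>?X. weight (?c z))"
    by (subst sum.reindex) (auto simp: inj_on_def)
  also have "\<dots> = (\<Sum>I\<in>Pow N. \<Sum>L\<in>?S (?N I) T. (\<Prod>B\<in>I. measure (Omega n M) (outcomes B)) * weight L)"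
    using finN finS by (subst sum.Sigma) (auto intro!: sum.cong simp: weight_def)
  also have "\<dots> \<le> (\<Sum>I\<in>Pow N. (exp 1 * p) ^ card I)"
    using layer by (intro sum_mono) auto
  also have "\<dots> = (1 + exp 1 * p) ^ card N"
    by (rule sum_Pow_power_card[OF finN])
  finally show ?case .
qed

text \<open>A union bound over \<open>k\<close> and the stable layerings for \<open>A k\<close>. By
  freshness each term factors into \<open>weight L\<close> and the probability of
  \<open>D k\<close>; disjointness of the \<open>D k\<close> then recovers the probability of the
  union instead of the sum over \<open>\<A>\<close>.\<close>

lemma measure_good_le:
  fixes p :: real and d r :: nat
  assumes p: "0 \<le> p" "\<And>B. B \<in> \<B> \<Longrightarrow> measure (Omega n M) (outcomes B) \<le> p"
    and d: "\<And>B. B \<in> \<B> \<Longrightarrow> card (neighbourhood \<B> B) \<le> d"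
    and epd: "exp 1 * p * real d \<le> 1"
    and \<A>: "finite \<A>" "\<And>A. A \<in> \<A> \<Longrightarrow> is_event n M A" "\<And>A. A \<in> \<A> \<Longrightarrow> card (neighbourhood \<B> A) \<le> r"
  shows "measure table (good T (\<Union>A\<in>\<A>. outcomes A)) \<le>
    measure (Omega n M) (\<Union>A\<in>\<A>. outcomes A) * (1 + exp 1 * p) ^ r"
proof -
  let ?m = "card \<A>"
  obtain A where "bij_betw A {0..<?m} \<A>"
    using ex_bij_betw_nat_finite[OF \<A>(1)] by blast
  then have image: "A ` {0..<?m} = \<A>" by (rule bij_betw_imp_surj_on)
  then have A: "A k \<in> \<A>" if "k < ?m" for k using that by auto
  define D where "D = disjointed (\<lambda>k. outcomes (A k))"
  let ?E = "\<Union>k\<in>{0..<?m}. outcomes (A k)"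
  have E: "(\<Union>A\<in>\<A>. outcomes A) = ?E" by (subst image[symmetric]) simp
  have outA: "outcomes (A k) \<in> sets (Omega n M)" if "k < ?m" for k
    using \<A>(2)[OF A[OF that]] by (simp add: is_event_def)
  have D: "D k \<in> sets (Omega n M)" if "k < ?m" for k
    using that outA unfolding D_def disjointed_def by (intro sets.Diff sets.finite_UN) auto
  let ?S = "\<lambda>k. {L. L \<in> layerings \<B> T \<and> stable \<B> (neighbourhood \<B> (A k)) L}"
  let ?G = "\<lambda>k L. {Y \<in> space table. valid n L Y \<and> after n L Y \<in> current n -` D k \<inter> space table}"
  have finS: "finite (?S k)" for k using finite_layerings[OF finite_bad] by simp
  have curD: "current n -` D k \<inter> space table \<in> sets table" if "k < ?m" for k
    using D[OF that] by measurable
  have G: "?G k L \<in> sets table" if "k < ?m" "L \<in> ?S k" for k L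
  proof -
    have "{Y \<in> space table. valid n L Y} \<in> sets table"
      using that by (intro layering_valid_sets) (auto simp: layerings_def)
    moreover have "{Y \<in> space table. after n L Y \<in> current n -` D k \<inter> space table} \<in> sets table"
      using curD[OF that(1)] by measurable
    ultimately show ?thesis by (intro sets.sets_Collect_conj)
  qed
  have "good T ?E \<subseteq> (\<Union>k\<in>{0..<?m}. \<Union>L\<in>?S k. ?G k L)"
  proof
    fix Y assume Y: "Y \<in> good T ?E"
    have "is_event n M (A k)" if "k < ?m" for k using \<A>(2) A that by blast
    then obtain k L where "k < ?m" "L \<in> ?S k" "valid n L Y" "current n (after n L Y) \<in> D k"
      using good_stable[OF _ Y] unfolding D_def by blast
    moreover have "Y \<in> space table" using Y by (simp add: good_def)
    ultimately show "Y \<in> (\<Union>k\<in>{0..<?m}. \<Union>L\<in>?S k. ?G k L)"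
      by (auto simp: after_in_space)
  qed
  then have "measure table (good T ?E) \<le> measure table (\<Union>k\<in>{0..<?m}. \<Union>L\<in>?S k. ?G k L)"
    using G finS by (intro table.finite_measure_mono sets.finite_UN) auto
  also have "\<dots> \<le> (\<Sum>k\<in>{0..<?m}. measure table (\<Union>L\<in>?S k. ?G k L))"
    using G finS by (intro table.finite_measure_subadditive_finite image_subsetI sets.finite_UN) auto
  also have "\<dots> \<le> (\<Sum>k\<in>{0..<?m}. measure (Omega n M) (D k) * (1 + exp 1 * p) ^ r)"
  proof (rule sum_mono)
    fix k assume "k \<in> {0..<?m}"
    then have k: "k < ?m" by simp
    have "measure table (current n -` D k \<inter> space table) =
        measure (distr table (Omega n M) (current n)) (D k)"
      using D[OF k] by (simp add: measure_distr)
    then have cur: "measure table (current n -` D k \<inter> space table) = measure (Omega n M) (D k)"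
      by (simp only: distr_current)
    have "measure table (\<Union>L\<in>?S k. ?G k L) \<le> (\<Sum>L\<in>?S k. measure table (?G k L))"
      using G[OF k] finS by (intro table.finite_measure_subadditive_finite image_subsetI) auto
    also have "\<dots> = (\<Sum>L\<in>?S k. weight L) * measure (Omega n M) (D k)"
      unfolding sum_distrib_right
      using measure_valid[OF _ curD[OF k]] by (intro sum.cong) (auto simp: cur)
    also have "\<dots> \<le> (1 + exp 1 * p) ^ card (neighbourhood \<B> (A k)) * measure (Omega n M) (D k)"
      using p d epd by (intro mult_right_mono sum_stable_weight_le) (auto simp: neighbourhood_def)
    also have "\<dots> \<le> (1 + exp 1 * p) ^ r * measure (Omega n M) (D k)"
      using p \<A>(3)[OF A[OF k]] by (intro mult_right_mono power_increasing) auto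
    finally show "measure table (\<Union>L\<in>?S k. ?G k L) \<le> measure (Omega n M) (D k) * (1 + exp 1 * p) ^ r"
      by (simp add: mult.commute)
  qed
  also have "\<dots> = measure (Omega n M) (\<Union>k\<in>{0..<?m}. D k) * (1 + exp 1 * p) ^ r"
  proof -
    have "disjoint_family_on D {0..<?m}"
      using disjoint_family_disjointed[of "\<lambda>k. outcomes (A k)"]
      by (auto simp: D_def disjoint_family_on_def)
    then have "measure (Omega n M) (\<Union>k\<in>{0..<?m}. D k) = (\<Sum>k\<in>{0..<?m}. measure (Omega n M) (D k))"
      using D by (intro Omega.finite_measure_finite_Union) auto
    then show ?thesis by (simp add: sum_distrib_right)
  qed
  also have "(\<Union>k\<in>{0..<?m}. D k) = ?E"
    unfolding D_def by (rule finite_UN_disjointed_eq)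
  finally show ?thesis by (simp only: E)
qed

end

section \<open>Superharmonicity\<close>

definition overwrite :: "nat \<Rightarrow> nat set \<Rightarrow> (nat \<Rightarrow> 'a) \<Rightarrow> (nat \<Rightarrow> 'a) \<Rightarrow> nat \<Rightarrow> 'a" where
  "overwrite n V x y = (\<lambda>i\<in>{1..n}. if i \<in> V then y i else x i)"

lemma resample_overwrite:
  "resample n M B x = distr (Omega n M) (Omega n M) (overwrite n (vars B) x)"
  by (simp add: resample_def overwrite_def[abs_def])

context independent_variables
begin

lemma measurable_overwrite:
  "(\<lambda>(x, y). overwrite n V x y) \<in> Omega n M \<Otimes>\<^sub>M Omega n M \<rightarrow>\<^sub>M Omega n M"
proof -
  let ?P = "Omega n M \<Otimes>\<^sub>M Omega n M"
  have "(\<lambda>z. overwrite n V (fst z) (snd z)) \<in> ?P \<rightarrow>\<^sub>M PiM {1..n} M"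
    unfolding overwrite_def
  proof (intro measurable_restrict)
    fix i assume "i \<in> {1..n}"
    then show "(\<lambda>z. if i \<in> V then snd z i else fst z i) \<in> ?P \<rightarrow>\<^sub>M M i"
      by (cases "i \<in> V") (auto intro!: measurable_compose[OF measurable_snd measurable_Omega_component]
        measurable_compose[OF measurable_fst measurable_Omega_component])
  qed
  then show ?thesis by (simp only: Omega_def split_beta')
qed

lemma measurable_overwrite_snd[measurable]:
  "x \<in> space (Omega n M) \<Longrightarrow> overwrite n V x \<in> Omega n M \<rightarrow>\<^sub>M Omega n M"
  using measurable_compose[OF measurable_Pair1' measurable_overwrite, of x V] by simp

lemma measurable_glue_all: "(\<lambda>(x, R). glue n {1..n} x R) \<in> Omega n M \<Otimes>\<^sub>M table \<rightarrow>\<^sub>M table"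
  using measurable_glue[of "{1..n}"] by (simp add: Omega_def)

lemma measurable_glue_snd[measurable]:
  "x \<in> space (Omega n M) \<Longrightarrow> glue n {1..n} x \<in> table \<rightarrow>\<^sub>M table"
  using measurable_compose[OF measurable_Pair1' measurable_glue_all, of x] by simp

text \<open>Both sides replace, in a fresh table, the top cells outside \<open>V\<close> by the values of \<open>x\<close>.\<close>

lemma nn_integral_overwrite:
  assumes V: "V \<subseteq> {1..n}" and x: "x \<in> space (Omega n M)" and f[measurable]: "f \<in> borel_measurable table"
  shows "(\<integral>\<^sup>+y. \<integral>\<^sup>+R. f (glue n {1..n} (overwrite n V x y) R) \<partial>table \<partial>Omega n M) =
    (\<integral>\<^sup>+R. f (advance n V (glue n {1..n} x R)) \<partial>table)"
proof -
  define top where "top Z = (\<lambda>j\<in>{1..n} \<times> UNIV. if snd j = 0 \<and> fst j \<notin> V then x (fst j) else Z j)"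
    for Z :: "nat \<times> nat \<Rightarrow> 'a"
  have "top \<in> table \<rightarrow>\<^sub>M PiM ({1..n} \<times> UNIV) (\<lambda>j. M (fst j))"
    unfolding top_def[abs_def]
  proof (intro measurable_restrict)
    fix j :: "nat \<times> nat" assume "j \<in> {1..n} \<times> UNIV"
    then show "(\<lambda>Z. if snd j = 0 \<and> fst j \<notin> V then x (fst j) else Z j) \<in> table \<rightarrow>\<^sub>M M (fst j)"
      using x measurable_cell[of "fst j" "snd j"]
      by (auto simp: Omega_def space_PiM PiE_iff)
  qed
  then have [measurable]: "top \<in> table \<rightarrow>\<^sub>M table" by (simp only: table_def)
  let ?C = "{1..n} - V"
  interpret C: prob_space "PiM ?C M" by (rule prob_space_PiM_vars) auto
  have "(\<integral>\<^sup>+y. \<integral>\<^sup>+R. f (glue n {1..n} (overwrite n V x y) R) \<partial>table \<partial>Omega n M) =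
      (\<integral>\<^sup>+y. \<integral>\<^sup>+R. f (top (glue n {1..n} y R)) \<partial>table \<partial>Omega n M)"
    by (intro nn_integral_cong arg_cong[of _ _ f])
      (auto simp: top_def glue_def overwrite_def fun_eq_iff split: nat.splits)
  also have "\<dots> = (\<integral>\<^sup>+Z. f (top Z) \<partial>table)"
    using nn_integral_glue[of "{1..n}" "\<lambda>Z. f (top Z)"] by (simp add: Omega_def)
  also have "\<dots> = (\<integral>\<^sup>+y. \<integral>\<^sup>+R. f (top (glue n ?C y R)) \<partial>table \<partial>PiM ?C M)"
    by (intro nn_integral_glue) auto
  \<comment> \<open>The split-off cells are exactly those that \<open>top\<close> replaces by values
    of \<open>x\<close>, so the integrand no longer depends on \<open>y\<close>.\<close>
  also have "\<dots> = (\<integral>\<^sup>+y. \<integral>\<^sup>+R. f (advance n V (glue n {1..n} x R)) \<partial>table \<partial>PiM ?C M)"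
    using V by (intro nn_integral_cong arg_cong[of _ _ f])
      (auto simp: top_def glue_def advance_def fun_eq_iff split: nat.splits)
  also have "\<dots> = (\<integral>\<^sup>+R. f (advance n V (glue n {1..n} x R)) \<partial>table)"
    by (simp add: C.emeasure_space_1)
  finally show ?thesis .
qed

lemma space_snapshot: "space (snapshot_space n M) = space (Omega n M) \<times> UNIV"
  by (simp add: snapshot_space_def space_pair_measure)

lemma measurable_snapshot[measurable]:
  "(\<lambda>x. (x, c)) \<in> Omega n M \<rightarrow>\<^sub>M snapshot_space n M"
  unfolding snapshot_space_def by measurable

lemma measurable_fst_snapshot[measurable]: "fst \<in> snapshot_space n M \<rightarrow>\<^sub>M Omega n M"
  unfolding snapshot_space_def by measurable

end

context bad_events
begin

text \<open>The conditional probability of \<open>good T E\<close> given that the configuration is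
  \<open>x\<close>: gluing along all variables puts \<open>x\<close> on top of a fresh
  table.\<close>

definition good_from :: "(nat \<Rightarrow> 'a) set \<Rightarrow> nat \<Rightarrow> (nat \<Rightarrow> 'a) \<Rightarrow> ennreal" where
  "good_from E T x = (\<integral>\<^sup>+R. indicator (good T E) (glue n {1..n} x R) \<partial>table)"

lemma measurable_good_from[measurable]:
  assumes [measurable]: "E \<in> sets (Omega n M)"
  shows "good_from E T \<in> borel_measurable (Omega n M)"
proof -
  note [measurable] = measurable_glue_all
  show ?thesis unfolding good_from_def[abs_def] by measurable
qed

lemma good_from_le_1: "good_from E T x \<le> 1"
proof -
  have "good_from E T x \<le> (\<integral>\<^sup>+R. 1 \<partial>table)"
    unfolding good_from_def by (intro nn_integral_mono) (simp add: indicator_def)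
  then show ?thesis by (simp add: table.emeasure_space_1)
qed

lemma glue_all_in_space:
  "x \<in> space (Omega n M) \<Longrightarrow> R \<in> space table \<Longrightarrow> glue n {1..n} x R \<in> space table"
  by (rule measurable_space[OF measurable_glue_snd])

lemma nn_integral_good_from:
  assumes [measurable]: "E \<in> sets (Omega n M)"
  shows "(\<integral>\<^sup>+x. good_from E T x \<partial>Omega n M) = emeasure table (good T E)"
  unfolding good_from_def
  using nn_integral_glue[of "{1..n}" "indicator (good T E)"] by (simp add: Omega_def)

lemma after_replicate_empty: "Y \<in> space table \<Longrightarrow> after n (replicate T {}) Y = Y"
  by (induction T) (auto simp: advance_empty)

lemma valid_replicate_empty: "valid n (replicate T {}) Y"
  by (induction T) auto

lemma good_from_eq_1:
  assumes "x \<in> E" "x \<in> space (Omega n M)"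
  shows "good_from E T x = 1"
proof -
  have "glue n {1..n} x R \<in> good T E" if "R \<in> space table" for R
  proof -
    have "replicate T {} \<in> layerings \<B> T"
      by (auto simp: layerings_def disjoint_family_on_def)
    with that assms show ?thesis unfolding good_def
      by (auto intro!: bexI[of _ "replicate T {}"]
        simp: glue_all_in_space after_replicate_empty valid_replicate_empty current_glue_all)
  qed
  then have "good_from E T x = (\<integral>\<^sup>+R. 1 \<partial>table)"
    unfolding good_from_def by (intro nn_integral_cong) auto
  then show ?thesis by (simp add: table.emeasure_space_1)
qed

text \<open>Executing \<open>I\<close> first means appending it at the end of the list. A singleton
  \<open>I\<close> models a step of the algorithm; the empty layer gives monotonicity in
  \<open>T\<close>.\<close>

lemma good_Suc_advance:
  assumes Y: "Y \<in> space table" and I: "I \<subseteq> \<B>" "disjoint_family_on vars I" "\<And>B. B \<in> I \<Longrightarrow> current n Y \<in> outcomes B"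
    and good: "advance n (\<Union>(vars ` I)) Y \<in> good T E"
  shows "Y \<in> good (Suc T) E"
proof -
  from good obtain L where "L \<in> layerings \<B> T" "valid n L (advance n (\<Union>(vars ` I)) Y)"
    "current n (after n L (advance n (\<Union>(vars ` I)) Y)) \<in> E"
    by (auto simp: good_def)
  then have "L @ [I] \<in> layerings \<B> (Suc T)" "valid n (L @ [I]) Y" "current n (after n (L @ [I]) Y) \<in> E"
    using I by (auto simp: layerings_def valid_append after_append)
  with Y show ?thesis unfolding good_def by blast
qed

lemma good_from_Suc: "x \<in> space (Omega n M) \<Longrightarrow> good_from E T x \<le> good_from E (Suc T) x"
  unfolding good_from_def
proof (intro nn_integral_mono)
  fix R assume "x \<in> space (Omega n M)" "R \<in> space table"
  then have "glue n {1..n} x R \<in> space table" by (rule glue_all_in_space)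
  then show "indicator (good T E) (glue n {1..n} x R) \<le>
      (indicator (good (Suc T) E) (glue n {1..n} x R) :: ennreal)"
    using good_Suc_advance[of "glue n {1..n} x R" "{}" T E]
    by (auto simp: indicator_def advance_empty disjoint_family_on_def)
qed

text \<open>A resampled configuration on top of a fresh table has the law of the table with the
  stacks of \<open>B\<close> popped, and a layering that succeeds there succeeds from
  \<open>x\<close> once \<open>{B}\<close> is executed before it.\<close>

lemma good_from_superharmonic:
  assumes [measurable]: "E \<in> sets (Omega n M)"
    and B: "B \<in> \<B>" "x \<in> outcomes B" and x: "x \<in> space (Omega n M)"
  shows "(\<integral>\<^sup>+y. good_from E T (overwrite n (vars B) x y) \<partial>Omega n M) \<le> good_from E (Suc T) x"
proof -
  have V: "vars B \<subseteq> {1..n}" using bad_event[OF B(1)] by (simp add: is_event_def)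
  have "(\<integral>\<^sup>+y. good_from E T (overwrite n (vars B) x y) \<partial>Omega n M) =
      (\<integral>\<^sup>+R. indicator (good T E) (advance n (vars B) (glue n {1..n} x R)) \<partial>table)"
    unfolding good_from_def by (intro nn_integral_overwrite V x) auto
  also have "\<dots> \<le> good_from E (Suc T) x"
    unfolding good_from_def
  proof (intro nn_integral_mono)
    fix R assume R: "R \<in> space table"
    then show "indicator (good T E) (advance n (vars B) (glue n {1..n} x R)) \<le>
        (indicator (good (Suc T) E) (glue n {1..n} x R) :: ennreal)"
      using good_Suc_advance[of "glue n {1..n} x R" "{B}" T E] B x
      by (auto simp: indicator_def glue_all_in_space current_glue_all disjoint_family_on_def)
  qed
  finally show ?thesis .
qed

end

section \<open>Runs of the algorithm\<close>

locale moser_tardos = bad_events n M \<B> for n and M :: "nat \<Rightarrow> 'a measure" and \<B> +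
  fixes sel :: "'a rule"
  assumes selection_rule: "is_selection_rule n M \<B> sel"
begin

abbreviation histories :: "nat \<Rightarrow> (nat \<Rightarrow> 'a snapshot) measure" where
  "histories t \<equiv> PiM {0..<t} (\<lambda>_. snapshot_space n M)"

abbreviation flawed :: "(nat \<Rightarrow> 'a) \<Rightarrow> bool" where
  "flawed x \<equiv> \<exists>B\<in>\<B>. x \<in> outcomes B"

lemma measurable_snapshot_at[measurable]: "s < t \<Longrightarrow> (\<lambda>h. h s) \<in> histories t \<rightarrow>\<^sub>M snapshot_space n M"
  by (rule measurable_component_singleton) simp

lemma measurable_configuration_at: "s < t \<Longrightarrow> (\<lambda>h. fst (h s)) \<in> histories t \<rightarrow>\<^sub>M Omega n M"
  by measurable

lemma configuration_in_space: "h \<in> space (histories t) \<Longrightarrow> s < t \<Longrightarrow> fst (h s) \<in> space (Omega n M)"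
  using measurable_space[OF measurable_configuration_at] by blast

section \<open>The transition kernels of the algorithm\<close>

lemma resampled_snapshot_in_subprob:
  assumes x: "x \<in> space (Omega n M)"
  shows "distr (resample n M B x) (snapshot_space n M) (\<lambda>x. (x, Some B)) \<in> space (subprob_algebra (snapshot_space n M))"
proof -
  interpret R: prob_space "resample n M B x"
    unfolding resample_overwrite using x by (intro Omega.prob_space_distr) measurable
  have "prob_space (distr (resample n M B x) (snapshot_space n M) (\<lambda>x. (x, Some B)))"
    by (intro R.prob_space_distr) (simp add: resample_overwrite)
  then show ?thesis
    by (simp add: space_subprob_algebra prob_space_imp_subprob_space)
qed

text \<open>Total mass, measurability and the supermartingale inequality are all read off this
  formula. The random choice becomes a finite sum because the rule only selects true
  bad-events.\<close>

lemma nn_integral_MT_kernel_Suc: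
  assumes h: "h \<in> space (histories (Suc t))" and g[measurable]: "g \<in> borel_measurable (snapshot_space n M)"
  shows "(\<integral>\<^sup>+s. g s \<partial>MT_kernel n M \<B> sel (Suc t) h) =
    (if flawed (fst (h t))
     then \<Sum>B\<in>\<B>. (\<integral>\<^sup>+y. g (overwrite n (vars B) (fst (h t)) y, Some B) \<partial>Omega n M) * ennreal (pmf (sel t h) B)
     else g (fst (h t), None))"
proof (cases "flawed (fst (h t))")
  case True
  have x: "fst (h t) \<in> space (Omega n M)" using h by (rule configuration_in_space) simp
  have [measurable]: "overwrite n V (fst (h t)) \<in> Omega n M \<rightarrow>\<^sub>M Omega n M" for V
    using x by (rule measurable_overwrite_snd)
  have supp: "set_pmf (sel t h) \<subseteq> {B \<in> \<B>. fst (h t) \<in> outcomes B}"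
    using selection_rule h True unfolding is_selection_rule_def by blast
  have "(\<integral>\<^sup>+s. g s \<partial>MT_kernel n M \<B> sel (Suc t) h) =
      (\<integral>\<^sup>+B. \<integral>\<^sup>+s. g s \<partial>distr (resample n M B (fst (h t))) (snapshot_space n M) (\<lambda>x. (x, Some B)) \<partial>sel t h)"
    using True x by (simp, subst nn_integral_bind[OF g]) (auto intro: resampled_snapshot_in_subprob)
  also have "\<dots> = (\<integral>\<^sup>+B. \<integral>\<^sup>+y. g (overwrite n (vars B) (fst (h t)) y, Some B) \<partial>Omega n M \<partial>sel t h)"
    by (intro nn_integral_cong) (simp add: resample_overwrite nn_integral_distr distr_distr comp_def)
  also have "\<dots> = (\<integral>\<^sup>+B. (\<integral>\<^sup>+y. g (overwrite n (vars B) (fst (h t)) y, Some B) \<partial>Omega n M) * indicator \<B> B \<partial>sel t h)"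
    using supp by (intro nn_integral_cong_AE) (auto simp: AE_measure_pmf_iff indicator_def)
  also have "\<dots> = (\<Sum>B\<in>\<B>. (\<integral>\<^sup>+y. g (overwrite n (vars B) (fst (h t)) y, Some B) \<partial>Omega n M) * ennreal (pmf (sel t h) B))"
    using finite_bad by (subst nn_integral_measure_pmf_support[of \<B>]) (auto intro!: sum.cong)
  finally show ?thesis using True by simp
next
  case False
  have "(fst (h t), None) \<in> space (snapshot_space n M)"
    using configuration_in_space[OF h, of t] by (simp add: space_snapshot)
  then show ?thesis using False by (simp add: nn_integral_return)
qed

lemma nn_integral_MT_kernel_0:
  "g \<in> borel_measurable (snapshot_space n M) \<Longrightarrow>
    (\<integral>\<^sup>+s. g s \<partial>MT_kernel n M \<B> sel 0 h) = (\<integral>\<^sup>+x. g (x, None) \<partial>Omega n M)"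
  by (simp add: nn_integral_distr)

lemma sets_MT_kernel:
  assumes "h \<in> space (histories t)"
  shows "sets (MT_kernel n M \<B> sel t h) = sets (snapshot_space n M)"
proof (cases t)
  case (Suc s)
  show ?thesis
    unfolding Suc by (auto intro!: sets_bind)
qed simp

lemma prob_space_MT_kernel:
  assumes h: "h \<in> space (histories t)"
  shows "prob_space (MT_kernel n M \<B> sel t h)"
proof (cases t)
  case 0
  then show ?thesis by (auto intro!: Omega.prob_space_distr)
next
  case (Suc s)
  have h': "h \<in> space (histories (Suc s))" using h Suc by simp
  have "emeasure (MT_kernel n M \<B> sel (Suc s) h) (space (MT_kernel n M \<B> sel (Suc s) h)) =
      (\<integral>\<^sup>+s. 1 \<partial>MT_kernel n M \<B> sel (Suc s) h)"
    by simp
  also have "\<dots> = (if flawed (fst (h s)) then \<Sum>B\<in>\<B>. ennreal (pmf (sel s h) B) else 1)"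
    using nn_integral_MT_kernel_Suc[OF h', of "\<lambda>_. 1"] by (simp add: Omega.emeasure_space_1)
  also have "\<dots> = 1"
  proof (cases "flawed (fst (h s))")
    case True
    then have "set_pmf (sel s h) \<subseteq> \<B>"
      using selection_rule h' unfolding is_selection_rule_def by blast
    with True show ?thesis
      using finite_bad by (simp add: sum_pmf_eq_1)
  qed simp
  finally show ?thesis unfolding Suc by (rule prob_spaceI)
qed

lemma measurable_MT_kernel:
  "MT_kernel n M \<B> sel t \<in> histories t \<rightarrow>\<^sub>M subprob_algebra (snapshot_space n M)"
proof (rule measurable_subprob_algebra)
  fix h assume "h \<in> space (histories t)"
  then show "subprob_space (MT_kernel n M \<B> sel t h)"
    "sets (MT_kernel n M \<B> sel t h) = sets (snapshot_space n M)"
    by (simp_all add: prob_space_MT_kernel prob_space_imp_subprob_space sets_MT_kernel)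
next
  fix A assume A[measurable]: "A \<in> sets (snapshot_space n M)"
  show "(\<lambda>h. emeasure (MT_kernel n M \<B> sel t h) A) \<in> borel_measurable (histories t)"
  proof (cases t)
    case 0
    then show ?thesis by simp
  next
    case (Suc s)
    let ?f = "\<lambda>h. if flawed (fst (h s))
      then \<Sum>B\<in>\<B>. (\<integral>\<^sup>+y. indicator A (overwrite n (vars B) (fst (h s)) y, Some B) \<partial>Omega n M) * ennreal (pmf (sel s h) B)
      else indicator A (fst (h s), None)"
    have "emeasure (MT_kernel n M \<B> sel (Suc s) h) A = ?f h" if h: "h \<in> space (histories (Suc s))" for h
      using nn_integral_MT_kernel_Suc[OF h, of "indicator A"] by (simp add: sets_MT_kernel[OF h])
    moreover have "?f \<in> borel_measurable (histories (Suc s))"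
    proof (intro measurable_If borel_measurable_sum borel_measurable_times_ennreal)
      have "{h \<in> space (histories (Suc s)). fst (h s) \<in> outcomes B} \<in> sets (histories (Suc s))"
        if "B \<in> \<B>" for B
        using measurable_bad[OF that] by measurable
      then show "{h \<in> space (histories (Suc s)). flawed (fst (h s))} \<in> sets (histories (Suc s))"
        by (intro sets.sets_Collect_finite_Ex finite_bad)
      show "(\<lambda>h. indicator A (fst (h s), None)) \<in> borel_measurable (histories (Suc s))"
        by measurable
    next
      fix B assume B: "B \<in> \<B>"
      note [measurable] = measurable_overwrite
      have "(\<lambda>x. \<integral>\<^sup>+y. indicator A (overwrite n (vars B) x y, Some B) \<partial>Omega n M) \<in> borel_measurable (Omega n M)"
        by measurable
      from measurable_compose[OF measurable_configuration_at this]
      show "(\<lambda>h. \<integral>\<^sup>+y. indicator A (overwrite n (vars B) (fst (h s)) y, Some B) \<partial>Omega n M)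
          \<in> borel_measurable (histories (Suc s))" by simp
      have "(\<lambda>h. pmf (sel s h) B) \<in> borel_measurable (histories (Suc s))"
        using selection_rule B by (simp add: is_selection_rule_def)
      then show "(\<lambda>h. ennreal (pmf (sel s h) B)) \<in> borel_measurable (histories (Suc s))"
        by measurable
    qed
    ultimately show ?thesis unfolding Suc by (subst measurable_cong)
  qed
qed

sublocale IT: Ionescu_Tulcea "MT_kernel n M \<B> sel" "\<lambda>_. snapshot_space n M"
  by (intro Ionescu_Tulcea.intro measurable_MT_kernel prob_space_MT_kernel)

section \<open>The supermartingale along a run\<close>

definition clean :: "(nat \<Rightarrow> 'a) set \<Rightarrow> (nat \<Rightarrow> 'a) set" where
  "clean E = {x \<in> space (Omega n M). x \<in> E \<and> \<not> flawed x}"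

lemma sets_clean: "E \<in> sets (Omega n M) \<Longrightarrow> clean E \<in> sets (Omega n M)"
  using finite_bad measurable_bad unfolding clean_def
  by (auto intro!: sets.sets_Collect_conj sets.sets_Collect_neg sets.sets_Collect_finite_Ex)

text \<open>\<open>T\<close> is the remaining budget of layers. Freezing the value at
  \<open>1\<close> after a visit to \<open>clean E\<close> makes the expectation at time
  \<open>t\<close> bound the probability of such a visit up to then.\<close>

definition potential :: "(nat \<Rightarrow> 'a) set \<Rightarrow> nat \<Rightarrow> nat \<Rightarrow> (nat \<Rightarrow> 'a snapshot) \<Rightarrow> ennreal" where
  "potential E T t h = (if \<exists>s\<le>t. fst (h s) \<in> clean E then 1 else good_from E T (fst (h t)))"

lemma sets_reached:
  assumes [measurable]: "D \<in> sets (Omega n M)" and "t < u"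
  shows "{h \<in> space (histories u). \<exists>s\<le>t. fst (h s) \<in> D} \<in> sets (histories u)"
proof -
  have "{h \<in> space (histories u). fst (h s) \<in> D} \<in> sets (histories u)" if "s \<in> {..t}" for s
  proof -
    have [measurable]: "(\<lambda>h. fst (h s)) \<in> histories u \<rightarrow>\<^sub>M Omega n M"
      using that assms(2) by (intro measurable_configuration_at) auto
    show ?thesis by measurable
  qed
  then have "{h \<in> space (histories u). \<exists>s\<in>{..t}. fst (h s) \<in> D} \<in> sets (histories u)"
    by (intro sets.sets_Collect_finite_Ex) auto
  then show ?thesis by (simp only: Bex_def atMost_iff)
qed

lemma measurable_potential:
  assumes E: "E \<in> sets (Omega n M)"
  shows "potential E T t \<in> borel_measurable (histories (Suc t))"
  unfolding potential_def[abs_def]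
proof (rule measurable_If)
  show "{h \<in> space (histories (Suc t)). \<exists>s\<le>t. fst (h s) \<in> clean E} \<in> sets (histories (Suc t))"
    using sets_clean[OF E] by (rule sets_reached) simp
  show "(\<lambda>h. good_from E T (fst (h t))) \<in> borel_measurable (histories (Suc t))"
    by (rule measurable_compose[OF measurable_configuration_at measurable_good_from[OF E]]) simp
qed simp

lemma measurable_fun_upd_history:
  "h \<in> space (histories t) \<Longrightarrow> (\<lambda>s. h(t := s)) \<in> snapshot_space n M \<rightarrow>\<^sub>M histories (Suc t)"
  by (intro measurable_fun_upd[where J="{0..<t}"]) auto

text \<open>A frozen value stays put, and an idle step only gives up one layer of budget. In a
  genuine step every event that the rule may select obeys \<open>good_from_superharmonic\<close>,
  hence so does their average.\<close>

lemma potential_superharmonic: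
  assumes E: "E \<in> sets (Omega n M)" and h: "h \<in> space (histories (Suc t))"
  shows "(\<integral>\<^sup>+s. potential E T (Suc t) (h(Suc t := s)) \<partial>MT_kernel n M \<B> sel (Suc t) h) \<le> potential E (Suc T) t h"
proof -
  interpret K: prob_space "MT_kernel n M \<B> sel (Suc t) h" using h by (rule prob_space_MT_kernel)
  let ?x = "fst (h t)"
  have x: "?x \<in> space (Omega n M)" using h by (rule configuration_in_space) simp
  have le: "potential E T (Suc t) (h(Suc t := s)) \<le> good_from E T (fst s)"
    if "s \<in> space (snapshot_space n M)" "\<not> (\<exists>u\<le>t. fst (h u) \<in> clean E)" for s
    using that good_from_eq_1[of "fst s" E T]
    by (auto simp: potential_def le_Suc_eq clean_def space_snapshot split: if_splits)
  show ?thesis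
  proof (cases "\<exists>u\<le>t. fst (h u) \<in> clean E")
    case True
    have "(\<integral>\<^sup>+s. potential E T (Suc t) (h(Suc t := s)) \<partial>MT_kernel n M \<B> sel (Suc t) h) \<le>
        (\<integral>\<^sup>+s. 1 \<partial>MT_kernel n M \<B> sel (Suc t) h)"
      by (intro nn_integral_mono) (auto simp: potential_def good_from_le_1)
    then show ?thesis using True K.emeasure_space_1 by (simp add: potential_def del: MT_kernel.simps)
  next
    case False
    have F: "(\<lambda>s. good_from E T (fst s)) \<in> borel_measurable (snapshot_space n M)"
      using measurable_good_from[OF E] by measurable
    have "(\<integral>\<^sup>+s. potential E T (Suc t) (h(Suc t := s)) \<partial>MT_kernel n M \<B> sel (Suc t) h) \<le>
        (\<integral>\<^sup>+s. good_from E T (fst s) \<partial>MT_kernel n M \<B> sel (Suc t) h)"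
      using le False sets_eq_imp_space_eq[OF sets_MT_kernel[OF h]] by (intro nn_integral_mono) auto
    also have "\<dots> = (if flawed ?x
        then \<Sum>B\<in>\<B>. (\<integral>\<^sup>+y. good_from E T (overwrite n (vars B) ?x y) \<partial>Omega n M) * ennreal (pmf (sel t h) B)
        else good_from E T ?x)"
      using nn_integral_MT_kernel_Suc[OF h F] by simp
    also have "\<dots> \<le> good_from E (Suc T) ?x"
    proof (cases "flawed ?x")
      case True
      then have supp: "set_pmf (sel t h) \<subseteq> {B \<in> \<B>. ?x \<in> outcomes B}"
        using selection_rule h unfolding is_selection_rule_def by blast
      have "(\<Sum>B\<in>\<B>. (\<integral>\<^sup>+y. good_from E T (overwrite n (vars B) ?x y) \<partial>Omega n M) * ennreal (pmf (sel t h) B)) \<le>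
          (\<Sum>B\<in>\<B>. good_from E (Suc T) ?x * ennreal (pmf (sel t h) B))"
      proof (rule sum_mono)
        fix B assume B: "B \<in> \<B>"
        show "(\<integral>\<^sup>+y. good_from E T (overwrite n (vars B) ?x y) \<partial>Omega n M) * ennreal (pmf (sel t h) B) \<le>
            good_from E (Suc T) ?x * ennreal (pmf (sel t h) B)"
        proof (cases "?x \<in> outcomes B")
          case True
          with E B x show ?thesis by (intro mult_right_mono good_from_superharmonic) auto
        next
          case False
          then have "pmf (sel t h) B = 0" using supp by (auto simp: set_pmf_iff)
          then show ?thesis by simp
        qed
      qed
      also have "\<dots> = good_from E (Suc T) ?x * ennreal (\<Sum>B\<in>\<B>. pmf (sel t h) B)"
        by (simp add: sum_distrib_left[symmetric] sum_ennreal)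
      also have "(\<Sum>B\<in>\<B>. pmf (sel t h) B) = 1"
        using supp finite_bad by (intro sum_pmf_eq_1) auto
      finally show ?thesis using True by simp
    qed (simp add: good_from_Suc x)
    also have "\<dots> = potential E (Suc T) t h" using False by (auto simp: potential_def)
    finally show ?thesis .
  qed
qed

text \<open>\<open>IT.C 0 (Suc t)\<close> is the law of the snapshots \<open>0, ..., t\<close>. Each
  step back in time is paid for by one more layer, so \<open>T + t\<close> stays constant; at time
  \<open>0\<close> the average over the initial draw turns \<open>good_from\<close> into
  \<open>good\<close>.\<close>

lemma nn_integral_potential_le:
  assumes E: "E \<in> sets (Omega n M)"
  shows "(\<integral>\<^sup>+h. potential E T t h \<partial>IT.C 0 (Suc t) (\<lambda>_. undefined)) \<le> emeasure table (good (T + t) E)"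
proof (induction t arbitrary: T)
  case 0
  let ?u = "\<lambda>_ :: nat. undefined :: 'a snapshot"
  have u: "?u \<in> space (histories 0)" by (simp add: space_PiM)
  note pot = measurable_potential[OF E, of T 0]
  have "(\<integral>\<^sup>+h. potential E T 0 h \<partial>IT.C 0 (Suc 0) ?u) = (\<integral>\<^sup>+h. potential E T 0 h \<partial>IT.eP 0 ?u)"
    using bind_return[OF IT.measurable_eP u] by (simp only: IT.C.simps add_0_right)
  also have "\<dots> = (\<integral>\<^sup>+s. potential E T 0 (?u(0 := s)) \<partial>MT_kernel n M \<B> sel 0 ?u)"
    by (rule IT.nn_integral_eP[OF u pot])
  also have "\<dots> = (\<integral>\<^sup>+x. potential E T 0 (?u(0 := (x, None))) \<partial>Omega n M)"
    using measurable_compose[OF measurable_fun_upd_history[OF u] pot] by (intro nn_integral_MT_kernel_0)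
  also have "\<dots> \<le> (\<integral>\<^sup>+x. good_from E T x \<partial>Omega n M)"
    using good_from_eq_1[of _ E T] by (intro nn_integral_mono) (auto simp: potential_def clean_def)
  finally show ?case by (simp add: nn_integral_good_from[OF E])
next
  case (Suc t)
  let ?u = "\<lambda>_ :: nat. undefined :: 'a snapshot"
  have u: "?u \<in> space (histories 0)" by (simp add: space_PiM)
  note pot = measurable_potential[OF E, of T "Suc t"]
  have "(\<integral>\<^sup>+h. potential E T (Suc t) h \<partial>IT.C 0 (Suc (Suc t)) ?u) =
      (\<integral>\<^sup>+h. \<integral>\<^sup>+h'. potential E T (Suc t) h' \<partial>IT.eP (Suc t) h \<partial>IT.C 0 (Suc t) ?u)"
    using pot u IT.measurable_eP[of "Suc t"]
    by (subst IT.C.simps(2), subst nn_integral_bind[where B="histories (Suc (Suc t))"])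
       (simp_all add: measurable_cong_sets[OF IT.sets_C[OF u] refl] del: IT.C.simps)
  also have "\<dots> \<le> (\<integral>\<^sup>+h. potential E (Suc T) t h \<partial>IT.C 0 (Suc t) ?u)"
  proof (rule nn_integral_mono)
    fix h assume "h \<in> space (IT.C 0 (Suc t) ?u)"
    then have h: "h \<in> space (histories (Suc t))" using IT.space_C[OF u, of "Suc t"] by simp
    show "(\<integral>\<^sup>+h'. potential E T (Suc t) h' \<partial>IT.eP (Suc t) h) \<le> potential E (Suc T) t h"
      using potential_superharmonic[OF E h, of T] by (simp only: IT.nn_integral_eP[OF h pot])
  qed
  also have "\<dots> \<le> emeasure table (good (Suc T + t) E)" by (rule Suc.IH)
  finally show ?case by simp
qed

text \<open>Visits to \<open>clean E\<close> up to time \<open>T\<close> depend on finitely many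
  snapshots and increase with \<open>T\<close>; a bound uniform in \<open>T\<close> therefore passes
  to the infinite run.\<close>

lemma MT_prob_le:
  assumes E: "E \<in> sets (Omega n M)" and c: "0 \<le> c" "\<And>T. measure table (good T E) \<le> c"
  shows "MT_prob n M \<B> sel E \<le> c"
proof -
  let ?\<L> = "MT_runs n M \<B> sel" and ?u = "\<lambda>_ :: nat. undefined :: 'a snapshot"
  have u: "?u \<in> space (histories 0)" by (simp add: space_PiM)
  have lim: "?\<L> = IT.PF.lim" by (simp add: MT_runs_def)
  define R where "R T u = {h \<in> space (histories u). \<exists>s\<le>T. fst (h s) \<in> clean E}" for T u
  define U where "U T = {\<omega> \<in> space ?\<L>. \<exists>s\<le>T. fst (\<omega> s) \<in> clean E}" for T
  have R: "R T (Suc T) \<in> sets (histories (Suc T))" for T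
    unfolding R_def using sets_clean[OF E] by (rule sets_reached) simp
  have U_emb: "U T = IT.PF.emb UNIV {0..<Suc T} (R T (Suc T))" for T
    by (auto simp: U_def R_def lim prod_emb_def space_PiM PiE_iff less_Suc_eq_le)
  have U: "U T \<in> sets ?\<L>" for T
    unfolding U_emb lim IT.PF.sets_lim using R by (intro measurable_prod_emb) auto
  have le: "emeasure ?\<L> (U T) \<le> ennreal c" for T
  proof -
    have "emeasure ?\<L> (U T) = emeasure (IT.CI {0..<Suc T}) (R T (Suc T))"
      unfolding U_emb lim by (rule IT.lim[OF _ R]) simp
    also have "\<dots> = emeasure (IT.C 0 (Suc T) ?u) (R T (Suc T))"
      using IT.emeasure_CI[OF subset_refl R, of T] sets.sets_into_space[OF R, of T]
      by (simp add: prod_emb_id space_PiM del: IT.C.simps)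
    also have "\<dots> = (\<integral>\<^sup>+h. indicator (R T (Suc T)) h \<partial>IT.C 0 (Suc T) ?u)"
      using R IT.sets_C[OF u, of "Suc T"] by (subst nn_integral_indicator) (simp_all del: IT.C.simps)
    \<comment> \<open>The budget is exhausted exactly at time \<open>T\<close>, so it amounts to
      \<open>T\<close> layers at time \<open>0\<close>.\<close>
    also have "\<dots> \<le> (\<integral>\<^sup>+h. potential E 0 T h \<partial>IT.C 0 (Suc T) ?u)"
      by (intro nn_integral_mono) (auto simp: indicator_def R_def potential_def)
    also have "\<dots> \<le> emeasure table (good (0 + T) E)"
      by (rule nn_integral_potential_le[OF E])
    also have "\<dots> \<le> ennreal c"
      using c by (simp add: table.emeasure_eq_measure)
    finally show ?thesis .
  qed
  have "incseq U" unfolding incseq_def U_def by (auto intro: le_trans)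
  then have "emeasure ?\<L> (\<Union>T. U T) = (SUP T. emeasure ?\<L> (U T))"
    using U by (intro SUP_emeasure_incseq[symmetric]) auto
  also have "\<dots> \<le> ennreal c" using le by (intro SUP_least)
  finally have union: "emeasure ?\<L> (\<Union>T. U T) \<le> ennreal c" .
  let ?W = "{\<omega> \<in> space ?\<L>. \<exists>t. terminates_at \<B> \<omega> t \<and> fst (\<omega> t) \<in> E}"
  have "?W \<subseteq> (\<Union>T. U T)"
  proof
    fix \<omega> assume "\<omega> \<in> ?W"
    then obtain t where \<omega>: "\<omega> \<in> space ?\<L>" "terminates_at \<B> \<omega> t" "fst (\<omega> t) \<in> E" by auto
    then have "\<omega> t \<in> space (snapshot_space n M)" by (auto simp: lim space_PiM)
    with \<omega> have "fst (\<omega> t) \<in> clean E" by (auto simp: clean_def terminates_at_def space_snapshot)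
    with \<omega> show "\<omega> \<in> (\<Union>T. U T)" by (auto simp: U_def)
  qed
  then have "emeasure ?\<L> ?W \<le> emeasure ?\<L> (\<Union>T. U T)"
    using U by (intro emeasure_mono sets.countable_UN) auto
  with union have "emeasure ?\<L> ?W \<le> ennreal c" by simp
  then show ?thesis
    unfolding MT_prob_def measure_def using c(1) by (simp add: enn2real_leI)
qed

end

theorem corollary3p6:
  fixes n :: nat and M :: "nat \<Rightarrow> 'a measure"
    and \<B> \<A> :: "'a event set" and sel :: "'a rule"
    and p :: real and d r :: nat
  assumes "\<And>i. i \<in> {1..n} \<Longrightarrow> prob_space (M i)"
    and "finite \<B>" and "\<And>B. B \<in> \<B> \<Longrightarrow> is_event n M B"
    and "is_selection_rule n M \<B> sel"
    and "0 \<le> p"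
    and "\<And>B. B \<in> \<B> \<Longrightarrow> measure (Omega n M) (outcomes B) \<le> p"
    and "\<And>B. B \<in> \<B> \<Longrightarrow> card (neighbourhood \<B> B) \<le> d"
    and "exp 1 * p * real d \<le> 1"
    and "finite \<A>" and "\<And>A. A \<in> \<A> \<Longrightarrow> is_event n M A"
    and "\<And>A. A \<in> \<A> \<Longrightarrow> card (neighbourhood \<B> A) \<le> r"
  shows "MT_prob n M \<B> sel (\<Union>A\<in>\<A>. outcomes A)
           \<le> measure (Omega n M) (\<Union>A\<in>\<A>. outcomes A) * (1 + exp 1 * p) ^ r"
proof -
  interpret moser_tardos n M \<B> sel
    using assms(1-4) by (intro moser_tardos.intro bad_events.intro independent_variables.intro
      bad_events_axioms.intro moser_tardos_axioms.intro)
  show ?thesis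
  \<comment> \<open>What remains concerns random stacks alone: the bound on \<open>good T\<close> is
    uniform in \<open>T\<close> and independent of \<open>sel\<close>.\<close>
  proof (rule MT_prob_le)
    show "(\<Union>A\<in>\<A>. outcomes A) \<in> sets (Omega n M)"
      using assms(9,10) by (intro sets.finite_UN) (auto simp: is_event_def)
    show "0 \<le> measure (Omega n M) (\<Union>A\<in>\<A>. outcomes A) * (1 + exp 1 * p) ^ r"
      using assms(5) by simp
    show "measure table (good T (\<Union>A\<in>\<A>. outcomes A)) \<le>
        measure (Omega n M) (\<Union>A\<in>\<A>. outcomes A) * (1 + exp 1 * p) ^ r" for T
      using assms(5-11) by (rule measure_good_le)
  qed
qed

end
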